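(* There exists a $(3,1)$-stochastic measure concentrated on the set $M$, i.e. a Borel probability measure $\mu$ on $[0,1]^3$ whose three one-dimensional marginals are all equal to Lebesgue measure on $[0,1]$ and such that $\mu(M)=1$.
   Context: Constants: $l\approx 0.0945$ is the unique root in $(0,1/4)$ of the equation $9t+\ln(1-2t)-\ln t-3=0$, and $r=1-2l$. The set $M\subset[0,1]^3$ is $M=M_x\cup M_y\cup M_z\cup M_2$, where $M_x=\{(t,1-2t,1-2t): 0\le t\le l\}$, $M_y=\{(1-2t,t,1-2t): 0\le t\le l\}$, $M_z=\{(1-2t,1-2t,t): 0\le t\le l\}$, $M_2=\{(x,y,z): l\le x,y,z\le r,\ xyz=lr^2\}$. *)

theory Defs
  imports "HOL-Probability.Probability"
begin

text \<open>
  The constant l_const is the root of this equation in the open interval from 0 to 1/4.  The equation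
  also has the root 1/3, so the restriction to that interval matters; the lemma below shows
  that the definite description is well defined.
\<close>

definition is_l_root :: "real \<Rightarrow> bool" where
  "is_l_root t \<longleftrightarrow> 0 < t \<and> t < 1/4 \<and> 9 * t + ln (1 - 2 * t) - ln t - 3 = 0"

lemma ex1_is_l_root: "\<exists>!t. is_l_root t"
proof -
  define f where "f = (\<lambda>t::real. 9 * t + ln (1 - 2 * t) - ln t - 3)"
  have der: "(f has_real_derivative 9 - 2 / (1 - 2 * t) - 1 / t) (at t)" if "0 < t" "t \<le> 1/4" for t
    using that unfolding f_def by (auto intro!: derivative_eq_intros)
  have cont: "continuous_on {a..b} f" if "0 < a" "b \<le> 1/4" for a b
    using that unfolding f_def by (auto intro!: continuous_intros)
  have deq: "9 - 2 / (1 - 2 * t) - 1 / t = - (6 * t - 1) * (3 * t - 1) / (t * (1 - 2 * t))"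
    if "0 < t" "t \<le> 1/4" for t :: real
    using that by (simp add: divide_simps) (simp add: algebra_simps)
  have dec: "f b < f a" if "0 < a" "a < b" "b \<le> 1/6" for a b
  proof (rule DERIV_neg_imp_decreasing_open[of a b f])
    fix t assume t: "a < t" "t < b"
    have "- (6 * t - 1) * (3 * t - 1) < 0" using t that by (intro mult_pos_neg) auto
    hence "9 - 2 / (1 - 2 * t) - 1 / t < 0"
      using t that by (subst deq) (auto intro!: divide_neg_pos)
    thus "\<exists>y. DERIV f t :> y \<and> y < 0" using der[of t] t that by auto
  qed (use that cont in auto)
  have inc: "f a \<le> f b" if "1/6 \<le> a" "a \<le> b" "b \<le> 1/4" for a b
  proof (rule DERIV_nonneg_imp_nondecreasing[of a b f])
    fix t assume t: "a \<le> t" "t \<le> b"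
    have "0 \<le> - (6 * t - 1) * (3 * t - 1)" using t that by (intro mult_nonpos_nonpos) auto
    hence "0 \<le> 9 - 2 / (1 - 2 * t) - 1 / t"
      using t that by (subst deq) (auto intro!: divide_nonneg_pos)
    thus "\<exists>y. DERIV f t :> y \<and> 0 \<le> y" using der[of t] t that by auto
  qed (use that in auto)
  have f4: "f (1/4) < 0"
  proof -
    have "ln (1/4) = ln ((1/2)\<^sup>2::real)" by (simp add: power2_eq_square)
    also have "\<dots> = 2 * ln (1/2)" by (simp add: ln_realpow)
    finally show ?thesis using ln2_le_25_over_36 by (simp add: f_def ln_div)
  qed
  have neg: "f t < 0" if "1/6 \<le> t" "t \<le> 1/4" for t using inc[of t "1/4"] f4 that by auto
  define a :: real where "a = exp (-4)"
  have a: "0 < a" "a < 1/16"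
  proof -
    have "16 < exp (4::real)"
      using exp_gt_one[of 4] exp_ge_add_one_self[of "1::real"]
        power_strict_mono[of 2 "exp 1 :: real" 4] exp_lower_Taylor_quadratic[of "1::real"]
      by (simp flip: exp_of_nat_mult)
    thus "a < 1/16" unfolding a_def by (simp add: exp_minus field_simps)
  qed (simp add: a_def)
  have "ln (1/2) \<le> ln (1 - 2 * a)" using a by (subst ln_le_cancel_iff) auto
  moreover have "ln a = -4" by (simp add: a_def)
  ultimately have fa: "0 \<le> f a" using a ln2_le_25_over_36 by (simp add: f_def ln_div)
  obtain t where t: "a \<le> t" "t \<le> 1/6" "f t = 0"
    using IVT2'[of f "1/6" 0 a] fa neg[of "1/6"] a cont[of a "1/6"] by auto
  have "is_l_root t" using t a by (simp add: is_l_root_def f_def)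
  moreover have "s = t" if "is_l_root s" for s
  proof -
    have s: "0 < s" "s < 1/4" "f s = 0" using that by (auto simp: is_l_root_def f_def)
    hence "s \<le> 1/6" using neg[of s] by force
    thus ?thesis using dec[of s t] dec[of t s] s t a by (cases s t rule: linorder_cases) auto
  qed
  ultimately show ?thesis by blast
qed

definition l_const :: real where
  "l_const = (THE t. is_l_root t)"

definition r_const :: real where
  "r_const = 1 - 2 * l_const"

definition M_x :: "(real \<times> real \<times> real) set" where
  "M_x = {(t, 1 - 2 * t, 1 - 2 * t) | t. 0 \<le> t \<and> t \<le> l_const}"

definition M_y :: "(real \<times> real \<times> real) set" where
  "M_y = {(1 - 2 * t, t, 1 - 2 * t) | t. 0 \<le> t \<and> t \<le> l_const}"

definition M_z :: "(real \<times> real \<times> real) set" where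
  "M_z = {(1 - 2 * t, 1 - 2 * t, t) | t. 0 \<le> t \<and> t \<le> l_const}"

definition M_2 :: "(real \<times> real \<times> real) set" where
  "M_2 = {(x, y, z). x \<in> {l_const..r_const} \<and> y \<in> {l_const..r_const} \<and> z \<in> {l_const..r_const} \<and> x * y * z = l_const * r_const\<^sup>2}"

definition M_set :: "(real \<times> real \<times> real) set" where
  "M_set = M_x \<union> M_y \<union> M_z \<union> M_2"

abbreviation unit_cube :: "(real \<times> real \<times> real) set" where
  "unit_cube \<equiv> {0..1} \<times> {0..1} \<times> {0..1}"

abbreviation lebesgue01 :: "real measure" where
  "lebesgue01 \<equiv> restrict_space lborel {0..1}"

text \<open>
  The underlying measurable space is the cube itself with its Borel sets, and marginals are
  push-forwards to the unit interval with its Borel sets.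
\<close>

definition stochastic_3_1 :: "(real \<times> real \<times> real) measure \<Rightarrow> bool" where
  "stochastic_3_1 \<mu> \<longleftrightarrow>
     prob_space \<mu> \<and> sets \<mu> = sets (restrict_space borel unit_cube) \<and>
     distr \<mu> lebesgue01 (\<lambda>(x, y, z). x) = lebesgue01 \<and>
     distr \<mu> lebesgue01 (\<lambda>(x, y, z). y) = lebesgue01 \<and>
     distr \<mu> lebesgue01 (\<lambda>(x, y, z). z) = lebesgue01"

end

(*
  In the logarithmic coordinates a = ln (r/x), M_2 becomes the triangle a + b + c = L, a, b, c >= 0 with
  L = ln (r/l), and Lebesgue measure on [l, r] becomes the density l e^(L - a) da on [0, L].  The
  equation that defines l says that this density has mean L/3, which is forced by a + b + c = L.
  Lebesgue measure on the segment M_x, parametrised by t, projects to full density on [0, l] and to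
  half density twice on [r, 1].  The triangle carries an explicit measure: a family of lines
  parallel to a side, with uniform mass along each line and density phi in the distance a from
  that side, plus segments from a vertex to the points of the opposite side at position s, with
  uniform mass along each segment and density s w(s).  The sum of its three one-dimensional marginals has density
    (L - a) phi(a) + 2 int_0^(L-a) phi + 1 + 2 int_a^L w = e^(L - a)    (up to the factor l).
  Averaging over cyclic permutations of the coordinates makes the three marginals equal.

  Requiring that s w(s) be symmetric under s -> L - s determines the odd part of phi about L/2 from its
  even part.  The even part is free; a quadratic polynomial is chosen for which phi and w are nonnegative.
*)
theory Submission imports Defs begin

section \<open>The constant l\<close>

lemma l_root: "is_l_root l_const"
  unfolding l_const_def by (rule theI'[OF ex1_is_l_root])

lemma l_const_bounds: "92/1000 < l_const" "l_const < 97/1000"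
proof -
  define f where "f = (\<lambda>t::real. 9 * t + ln (1 - 2 * t) - ln t - 3)"
  have ln8: "ln 8 = 3 * ln (2::real)" using ln_realpow[of 2 3] by simp
  \<comment> \<open>At t = 92/1000 the quotient (1 - 2 t)/t is 816/92 and 3 - 9 t is 2172/1000; at t
    = 97/1000 they are 806/97 and 2127/1000. Splitting off the factor 8 leaves a number near 1, for
    which ln x \<le> x - 1 is sharp enough.\<close>
  have a: "ln (816/92) > (2172/1000::real)"
  proof -
    have "ln (816/92::real) = ln (8 * (51/46))" by simp
    also have "\<dots> = 3 * ln 2 + ln (51/46)" using ln8 by (subst ln_mult) auto
    also have "ln (51/46::real) = - ln (46/51)" by (simp add: ln_div)
    finally show ?thesis
      using ln_le_minus_one[of "46/51::real"] ln_approx_bounds[of 2 3]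
      by (simp add: eval_nat_numeral)
  qed
  have b: "ln (806/97) < (2127/1000::real)"
  proof -
    have "ln (806/97::real) = ln (8 * (403/388))" by simp
    also have "\<dots> = 3 * ln 2 + ln (403/388)" using ln8 by (subst ln_mult) auto
    finally show ?thesis using ln_le_minus_one[of "403/388::real"] ln2_le_25_over_36 by simp
  qed
  have f_eq: "f t = 9 * t + ln ((1 - 2 * t) / t) - 3" if "0 < t" "t < 1/2" for t
    using that by (simp add: f_def ln_div)
  have fa: "f (92/1000) > 0" using a by (simp add: f_eq)
  have fb: "f (97/1000) < 0" using b by (simp add: f_eq)
  have "continuous_on {92/1000..97/1000} f"
    unfolding f_def by (auto intro!: continuous_intros)
  then obtain t where t: "92/1000 \<le> t" "t \<le> 97/1000" "f t = 0"
    using IVT2'[of f "97/1000" 0 "92/1000"] fa fb by auto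
  have "t \<noteq> 92/1000" "t \<noteq> 97/1000" using fa fb t by fastforce+
  moreover have "is_l_root t" using t by (simp add: is_l_root_def f_def)
  hence "t = l_const" using l_root ex1_is_l_root by blast
  ultimately show "92/1000 < l_const" "l_const < 97/1000" using t by auto
qed

text \<open>By the equation for \<open>l_const\<close> this is ln (r/l); the linear form turns
  bounds on \<open>l_const\<close> directly into bounds on L.\<close>

definition L_const :: real where "L_const = 3 - 9 * l_const"

lemma L_const_bounds: "2127/1000 \<le> L_const" "L_const \<le> 2172/1000"
  using l_const_bounds by (auto simp: L_const_def)

lemma l_const_pos: "0 < l_const" "l_const < r_const"
  using l_const_bounds by (auto simp: r_const_def)

lemma l_const_exp: "l_const * exp L_const = r_const"
proof -
  have "L_const = ln r_const - ln l_const"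
    using l_root by (simp add: is_l_root_def L_const_def r_const_def)
  moreover have "0 < r_const" using l_const_pos by linarith
  ultimately have "exp L_const = r_const / l_const" using l_const_pos exp_diff[of "ln r_const" "ln l_const"] by simp
  thus ?thesis using l_const_pos by simp
qed

text \<open>Since l = (3 - L)/9 and r = (3 + 2 L)/9, this is r = l e^L. Written in L alone, it says
  that the density proportional to e^(L - a) on [0, L] has mean L/3.\<close>

lemma L_const_equation: "(3 - L_const) * exp L_const = 3 + 2 * L_const"
  using l_const_exp by (simp add: L_const_def r_const_def)

text \<open>The square of exp (L/2) is r/l, so the bounds on \<open>l_const\<close> suffice and no
  exponential is evaluated numerically.\<close>

lemma exp_half_L_const_bounds: "288/100 \<le> exp (L_const/2)" "exp (L_const/2) \<le> 298/100"
proof -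
  have sq: "(exp (L_const/2))\<^sup>2 = r_const / l_const"
    using l_const_exp l_const_pos by (simp add: field_simps flip: exp_double)
  have "(288/100)\<^sup>2 \<le> r_const / l_const" "r_const / l_const \<le> (298/100)\<^sup>2"
    using l_const_bounds by (auto simp: r_const_def field_simps power2_eq_square)
  thus "288/100 \<le> exp (L_const/2)" "exp (L_const/2) \<le> 298/100"
    unfolding sq[symmetric] by (auto intro: power2_le_imp_le)
qed

section \<open>Densities on the triangle\<close>

lemma deriv_le_imp_le:
  fixes f g :: "real \<Rightarrow> real"
  assumes "f 0 \<le> g 0" "0 \<le> x"
    and "\<And>t. 0 \<le> t \<Longrightarrow> t \<le> x \<Longrightarrow> (f has_real_derivative f' t) (at t)"
    and "\<And>t. 0 \<le> t \<Longrightarrow> t \<le> x \<Longrightarrow> (g has_real_derivative g' t) (at t)"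
    and "\<And>t. 0 \<le> t \<Longrightarrow> t \<le> x \<Longrightarrow> f' t \<le> g' t"
  shows "f x \<le> g x"
proof -
  have "g 0 - f 0 \<le> g x - f x"
  proof (rule DERIV_nonneg_imp_nondecreasing[of 0 x "\<lambda>t. g t - f t"])
    fix t assume t: "0 \<le> t" "t \<le> x"
    show "\<exists>y. ((\<lambda>t. g t - f t) has_real_derivative y) (at t) \<and> 0 \<le> y"
      using assms(3-5)[OF t] by (intro exI[of _ "g' t - f' t"]) (auto intro: DERIV_diff)
  qed fact
  thus ?thesis using assms(1) by simp
qed

lemma le_sinh: "x \<le> sinh x" if "0 \<le> x" for x :: real
  by (rule deriv_le_imp_le[where f = "\<lambda>t. t" and f' = "\<lambda>_. 1" and g' = cosh])
     (use that cosh_real_ge_1 in \<open>auto intro!: derivative_eq_intros\<close>)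

text \<open>A bootstrap: a crude constant bound on cosh is integrated repeatedly, alternating
  between sinh and cosh, until the coefficients are good enough. The range up to 109/100 covers L/2
  \<le> 1086/1000.\<close>

lemma sinh_le: "sinh x \<le> x + x ^ 3 / 5" if "0 \<le> x" "x \<le> 109/100" for x :: real
proof -
  have e: "exp (11/10) \<le> (3.1::real)"
  proof -
    have "exp (11/10::real) = exp (1 / 10) * exp 1" by (simp flip: exp_add)
    also have "\<dots> \<le> (1 + 1/10 + (1/10)^2) * (272/100)"
      using exp_bound[of "1/10"] e_less_272 by (intro mult_mono) auto
    also have "\<dots> \<le> 3.1" by (simp add: power2_eq_square)
    finally show ?thesis .
  qed
  have c0: "cosh t \<le> 2" if "0 \<le> t" "t \<le> 109/100" for t :: real
  proof -
    have "cosh t \<le> cosh (11/10)" using that by (subst cosh_real_nonneg_le_iff) auto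
    moreover have "exp (-(11/10)) \<le> (1 / (1 + 11/10) :: real)"
      using exp_ge_add_one_self[of "11/10"] by (simp add: exp_minus field_simps)
    ultimately show ?thesis using e unfolding cosh_field_def by (simp add: field_simps)
  qed
  have s1: "sinh t \<le> 2 * t" if "0 \<le> t" "t \<le> 109/100" for t :: real
    by (rule deriv_le_imp_le[where g' = "\<lambda>_. 2" and f' = cosh])
       (use that c0 in \<open>auto intro!: derivative_eq_intros\<close>)
  have c1: "cosh t \<le> 1 + t\<^sup>2" if "0 \<le> t" "t \<le> 109/100" for t :: real
    by (rule deriv_le_imp_le[where g' = "\<lambda>t. 2 * t" and f' = sinh])
       (use that s1 in \<open>auto intro!: derivative_eq_intros\<close>)
  have s2: "sinh t \<le> t + t^3 / 3" if "0 \<le> t" "t \<le> 109/100" for t :: real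
    by (rule deriv_le_imp_le[where g' = "\<lambda>t. 1 + t\<^sup>2" and f' = cosh])
       (use that c1 in \<open>auto intro!: derivative_eq_intros\<close>)
  have c2: "cosh t \<le> 1 + t\<^sup>2 / 2 + t ^ 4 / 12" if "0 \<le> t" "t \<le> 109/100" for t :: real
    by (rule deriv_le_imp_le[where g' = "\<lambda>t. t + t^3 / 3" and f' = sinh])
       (use that s2 in \<open>auto intro!: derivative_eq_intros\<close>)
  have c3: "cosh t \<le> 1 + 3 / 5 * t\<^sup>2" if "0 \<le> t" "t \<le> 109/100" for t :: real
  proof -
    have "t * t \<le> (109/100) * (109/100)" using that by (intro mult_mono) auto
    \<comment> \<open>As t^2 \<le> 6/5, the term t^4/12 is at most t^2/10, and 1/2 + 1/10 =
      3/5.\<close>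
    hence "t\<^sup>2 * t\<^sup>2 \<le> 6/5 * t\<^sup>2" by (intro mult_right_mono) (auto simp: power2_eq_square)
    thus ?thesis using c2[OF that] by (simp flip: power_add)
  qed
  show ?thesis
    by (rule deriv_le_imp_le[where g' = "\<lambda>t. 1 + 3 / 5 * t\<^sup>2" and f' = cosh])
       (use that c3 in \<open>auto intro!: derivative_eq_intros\<close>)
qed

text \<open>The derivative of x cosh x - sinh x is x sinh x, which is at least x^2. The upper bound
  that follows integrates x sinh x \<le> x^2 + x^4/5 in the same way.\<close>

lemma x_cosh_minus_sinh_ge: "x ^ 3 / 3 \<le> x * cosh x - sinh x" if "0 \<le> x" for x :: real
  by (rule deriv_le_imp_le[where f = "\<lambda>x. x ^ 3 / 3" and g = "\<lambda>x. x * cosh x - sinh x"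
        and f' = "\<lambda>t. t\<^sup>2" and g' = "\<lambda>t. t * sinh t"])
     (use that le_sinh in \<open>auto intro!: derivative_eq_intros mult_left_mono simp: power2_eq_square\<close>)

lemma x_cosh_minus_sinh_le: "x * cosh x - sinh x \<le> x ^ 3 / 3 + x ^ 5 / 25"
  if "0 \<le> x" "x \<le> 109/100" for x :: real
proof (rule deriv_le_imp_le[where f = "\<lambda>x. x * cosh x - sinh x" and g = "\<lambda>x. x ^ 3 / 3 + x ^ 5 / 25"
      and f' = "\<lambda>t. t * sinh t" and g' = "\<lambda>t. t * (t + t ^ 3 / 5)"])
  show "t * sinh t \<le> t * (t + t ^ 3 / 5)" if "0 \<le> t" "t \<le> x" for t
    using that \<open>x \<le> 109/100\<close> sinh_le by (intro mult_left_mono) auto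
  show "((\<lambda>x. x ^ 3 / 3 + x ^ 5 / 25) has_real_derivative t * (t + t ^ 3 / 5)) (at t)" for t :: real
    by (auto intro!: derivative_eq_intros simp: algebra_simps eval_nat_numeral)
  show "((\<lambda>x. x * cosh x - sinh x) has_real_derivative t * sinh t) (at t)" for t :: real
    by (auto intro!: derivative_eq_intros)
qed (use that in auto)

text \<open>With x = L/2 - a the expression is L times \<open>tri_density\<close>. Its
  transcendental part is e^(L/2) times an odd function of x, so that function is bounded at y = |x|,
  from below if x \<ge> 0 and from above if x < 0. What remains is a polynomial inequality in
  y.\<close>

lemma centred_density_nonneg:
  fixes L x :: real
  assumes L: "2127/1000 \<le> L" "L \<le> 2172/1000"
    and q: "288/100 \<le> exp (L/2)" "exp (L/2) \<le> 298/100"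
    and x: "\<bar>x\<bar> \<le> L/2"
  shows "0 \<le> (L/2 + x) * exp (L/2 - x) - (L/2 - x) * exp (L/2 + x)
             + L/12 + x/2 + x\<^sup>2/L - 10 * x^3 / L\<^sup>2"
proof -
  define q where "q = exp (L/2)"
  define y where "y = \<bar>x\<bar>"
  define U where "U = 2 * (y * cosh y - sinh y) - (L - 2) * sinh y"
  have y: "0 \<le> y" "y \<le> 1086/1000" using x L by (auto simp: y_def)
  have q_pos: "0 < q" "288/100 \<le> q" "q \<le> 298/100" using q by (auto simp: q_def)
  have exps: "exp (L/2 - t) = q * (cosh t - sinh t)" "exp (L/2 + t) = q * (cosh t + sinh t)" for t
    by (simp_all add: q_def cosh_minus_sinh cosh_plus_sinh flip: exp_add)
  \<comment> \<open>L is close to 2: splitting L sinh t leaves 2 (t cosh t - sinh t), which is of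
    order t^3, and a small multiple of sinh t.\<close>
  have main: "(L/2 + t) * exp (L/2 - t) - (L/2 - t) * exp (L/2 + t)
      = q * (2 * (t * cosh t - sinh t) - (L - 2) * sinh t)" for t
    unfolding exps by (simp add: algebra_simps)
  have Linv: "46/100 * y\<^sup>2 \<le> y\<^sup>2 / L"
  proof -
    have "46/100 \<le> 1 / L" using L by (simp add: field_simps)
    from mult_right_mono[OF this, of "y\<^sup>2"] show ?thesis by simp
  qed
  have y3: "y^3 \<le> 1086/1000 * y\<^sup>2"
    using mult_right_mono[OF y(2), of "y\<^sup>2"] by (simp add: power3_eq_cube power2_eq_square)
  have y30: "0 \<le> y^3" using y by simp
  have LL: "L\<^sup>2 \<ge> (2127/1000)\<^sup>2" "L\<^sup>2 \<le> (2172/1000)\<^sup>2" using L by (auto intro!: power_mono)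
  have "0 < L" using L by simp
  show ?thesis
  proof (cases "0 \<le> x")
    case True
    hence xy: "x = y" by (simp add: y_def)
    have "U \<ge> 2 * (y^3 / 3) - (L - 2) * (y + y^3 / 5)"
      unfolding U_def using x_cosh_minus_sinh_ge[of y] sinh_le[of y] y L
      by (intro diff_mono mult_left_mono) auto
    hence "q * U \<ge> q * (2 * (y^3 / 3) - (L - 2) * (y + y^3 / 5))"
      using q_pos by (intro mult_left_mono) auto
    also have "q * (2 * (y^3 / 3) - (L - 2) * (y + y^3 / 5))
        = (q * (16/15 - L/5)) * y^3 - (q * (L - 2)) * y"
      by (simp add: field_simps)
    finally have 1: "(q * (16/15 - L/5)) * y^3 - (q * (L - 2)) * y \<le> q * U" .
    have "6322/10000 \<le> 16/15 - L/5" using L by linarith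
    hence "288/100 * (6322/10000) \<le> q * (16/15 - L/5)"
      using q_pos by (intro mult_mono) auto
    from mult_right_mono[OF this y30]
    have 2: "18207/10000 * y^3 \<le> (q * (16/15 - L/5)) * y^3" using y30 by linarith
    have "q * (L - 2) \<le> 298/100 * (172/1000)" using q_pos L by (intro mult_mono) auto
    from mult_right_mono[OF this y(1)]
    have 3: "(q * (L - 2)) * y \<le> 513/1000 * y" using y by simp
    have "10 / L\<^sup>2 \<le> 2211/1000" using LL \<open>0 < L\<close> by (simp add: field_simps power2_eq_square)
    from mult_right_mono[OF this y30] have 4: "10 * y^3 / L\<^sup>2 \<le> 2211/1000 * y^3" by simp
    \<comment> \<open>The cubic terms leave a deficit below 0.4 y^3, which y^2/L covers by way of
      \<open>y3\<close>; the small linear deficit is covered by L/12.\<close>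
    have "0 \<le> q * U + L/12 + y/2 + y\<^sup>2/L - 10 * y^3 / L\<^sup>2"
      using 1 2 3 4 Linv y3 y L zero_le_power2[of y] by linarith
    thus ?thesis unfolding main by (simp add: U_def xy)
  next
    case False
    hence xy: "x = -y" by (simp add: y_def)
    have "U \<le> 2 * (y^3 / 3 + y^5 / 25) - (L - 2) * y"
      unfolding U_def using x_cosh_minus_sinh_le[of y] le_sinh[of y] y L
      by (intro diff_mono mult_left_mono) auto
    hence "q * U \<le> q * (2 * (y^3 / 3 + y^5 / 25) - (L - 2) * y)"
      using q_pos by (intro mult_left_mono) auto
    also have "\<dots> = (q * (2/3 + 2 * y\<^sup>2 / 25)) * y^3 - (q * (L - 2)) * y"
      by (simp add: field_simps eval_nat_numeral)
    finally have 1: "q * U \<le> (q * (2/3 + 2 * y\<^sup>2 / 25)) * y^3 - (q * (L - 2)) * y" .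
    have "y\<^sup>2 \<le> (1086/1000)\<^sup>2" using y by (intro power_mono) auto
    hence "q * (2/3 + 2 * y\<^sup>2 / 25) \<le> 298/100 * (762/1000)"
      using q_pos by (intro mult_mono) (auto simp: power2_eq_square)
    from mult_right_mono[OF this y30]
    have 2: "(q * (2/3 + 2 * y\<^sup>2 / 25)) * y^3 \<le> 2271/1000 * y^3" using y30 by linarith
    have "288/100 * (127/1000) \<le> q * (L - 2)" using q_pos L by (intro mult_mono) auto
    from mult_right_mono[OF this y(1)]
    have 3: "365/1000 * y \<le> (q * (L - 2)) * y" using y by simp
    have "2119/1000 \<le> 10 / L\<^sup>2" using LL \<open>0 < L\<close> by (simp add: field_simps power2_eq_square)
    from mult_right_mono[OF this y30] have 4: "2119/1000 * y^3 \<le> 10 * y^3 / L\<^sup>2" by simp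
    \<comment> \<open>The tangent of y^2 at 1/5, near the minimum of the quadratic that is left,
      makes the final inequality linear.\<close>
    have "0 \<le> (y - 1/5)\<^sup>2" by simp
    hence "2/5 * y - 1/25 \<le> y\<^sup>2" by (simp add: power2_eq_square field_simps)
    hence "0 \<le> - (q * U) + L/12 - y/2 + y\<^sup>2/L + 10 * y^3 / L\<^sup>2"
      using 1 2 3 4 Linv y3 y L by linarith
    thus ?thesis unfolding main by (simp add: U_def xy algebra_simps)
  qed
qed

text \<open>
  Put E(a) = (L - a) e^a - a e^(L - a) and sigma(a) = phi(a) + phi(L - a).  The symmetry of s w(s)
  amounts to L phi(a) = E(a) + (3 a - L) sigma(a) - a (L - a) sigma'(a).  The density below belongs to
  sigma = 1/6 + 2 x^2/L^2 with x = L/2 - a; the coefficients 1/6 and 2 were found numerically so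
  that phi is nonnegative.
\<close>

definition tri_density :: "real \<Rightarrow> real \<Rightarrow> real" where
  "tri_density L a = (let x = L/2 - a in
     ((L - a) * exp a - a * exp (L - a) + L/12 + x/2 + x\<^sup>2/L - 10 * x^3 / L\<^sup>2) / L)"

text \<open>This is w, found by differentiating the marginal equation: 2 w(a) = (L - a) phi'(a) -
  phi(a) - 2 phi(L - a) + e^(L - a). The factor L - s and the bracket, symmetric under s -> L - s,
  make the symmetry of s w(s) visible.\<close>

definition ray_density :: "real \<Rightarrow> real \<Rightarrow> real" where
  "ray_density L s =
     (L - s) / (2 * L) * (s * exp (L - s) + (L - s) * exp s - 1 + 20 * (L/2 - s)\<^sup>2 / L\<^sup>2)"

section \<open>Antiderivatives of the densities and the mass of the segments\<close>

definition tri_primitive :: "real \<Rightarrow> real \<Rightarrow> real" where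
  "tri_primitive L a = (let x = L/2 - a in
     ((L - a + 1) * exp a + (a + 1) * exp (L - a)
       - L * x/12 - x\<^sup>2/4 - x^3/(3 * L) + 5 * x^4 / (2 * L\<^sup>2)) / L)"

lemma tri_primitive_deriv:
  assumes "L > 0"
  shows "(tri_primitive L has_real_derivative tri_density L a) (at a)"
proof -
  define x where "x = L/2 - a"
  have "(tri_primitive L has_real_derivative
    (- exp a + (L - a + 1) * exp a + (exp (L - a) - (a + 1) * exp (L - a))
      + L/12 + x/2 + x\<^sup>2/L - 10 * x^3 / L\<^sup>2) / L) (at a)"
    unfolding tri_primitive_def Let_def x_def divide_inverse
    by (rule derivative_eq_intros refl)+
       (simp add: algebra_simps eval_nat_numeral, use assms in \<open>simp add: field_simps\<close>)
  thus ?thesis unfolding tri_density_def Let_def x_def by (simp add: algebra_simps)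
qed

text \<open>An antiderivative W of 2 w that is read off from the marginal equation instead of being
  integrated. With this choice the equation reduces to W(L) = -1.\<close>

definition ray_primitive :: "real \<Rightarrow> real \<Rightarrow> real" where
  "ray_primitive L a = (L - a) * tri_density L a + 2 * (tri_primitive L (L - a) - tri_primitive L 0)
     - exp (L - a)"

lemma ray_primitive_deriv:
  assumes "L > 0"
  shows "(ray_primitive L has_real_derivative 2 * ray_density L a) (at a)"
proof -
  define x where "x = L/2 - a"
  have d: "(tri_density L has_real_derivative
    ((L - a - 1) * exp a + (a - 1) * exp (L - a) - 1/2 - 2 * x/L + 30 * x\<^sup>2 / L\<^sup>2) / L) (at a)"
    unfolding tri_density_def Let_def x_def divide_inverse
    by (rule derivative_eq_intros refl)+ (simp add: algebra_simps eval_nat_numeral)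
  show ?thesis unfolding ray_primitive_def
    by (rule DERIV_cong, (rule derivative_intros d DERIV_chain'[OF _ tri_primitive_deriv] assms refl)+)
       (use assms in \<open>simp add: tri_density_def ray_density_def Let_def x_def divide_simps\<close>,
        simp add: algebra_simps eval_nat_numeral)
qed

text \<open>Since exp is at least 1 on [0, L], the two exponential terms sum to at least s + (L - s)
  = L \<ge> 1, which pays for the -1.\<close>

lemma ray_density_nonneg:
  assumes L: "1 \<le> L" and s: "0 \<le> s" "s \<le> L"
  shows "0 \<le> ray_density L s"
proof -
  have "s * 1 + (L - s) * 1 \<le> s * exp (L - s) + (L - s) * exp s"
    using s by (intro add_mono mult_left_mono) auto
  thus ?thesis unfolding ray_density_def using L s
    by (intro mult_nonneg_nonneg add_nonneg_nonneg divide_nonneg_nonneg) auto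
qed

lemma ray_density_reflect: "(L - s) * ray_density L (L - s) = s * ray_density L s"
proof -
  have "(L/2 - (L - s))\<^sup>2 = (L/2 - s)\<^sup>2" by (simp add: power2_eq_square algebra_simps)
  thus ?thesis unfolding ray_density_def
    by (simp only: diff_diff_eq2 add_diff_cancel_left' diff_add_cancel add.commute[of "(L - s) * exp s"])
       simp
qed

text \<open>An antiderivative of s w(s). Here A is an antiderivative of t (L - t)^2 e^t, and -A(L -
  s) takes care of the reflected term s^2 (L - s) e^(L - s).\<close>

definition ray_mass_primitive :: "real \<Rightarrow> real \<Rightarrow> real" where
  "ray_mass_primitive L s =
     (let A = (\<lambda>t. (t^3 - (2 * L + 3) * t\<^sup>2 + (L\<^sup>2 + 4 * L + 6) * (t - 1)) * exp t); x = L/2 - s in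
      (A s - A (L - s) - L * s\<^sup>2 / 2 + s^3 / 3 - 5 * x^3 / 3 + 4 * x^5 / L\<^sup>2) / (2 * L))"

lemma ray_mass_primitive_deriv:
  assumes "L > 0"
  shows "(ray_mass_primitive L has_real_derivative s * ray_density L s) (at s)"
proof -
  define A where "A = (\<lambda>t. (t^3 - (2 * L + 3) * t\<^sup>2 + (L\<^sup>2 + 4 * L + 6) * (t - 1)) * exp t)"
  have A: "(A has_real_derivative t * (L - t)\<^sup>2 * exp t) (at t)" for t
    unfolding A_def
    by (rule derivative_eq_intros refl)+ (simp add: algebra_simps eval_nat_numeral)
  define x where "x = L/2 - s"
  have "((\<lambda>s. (A s - A (L - s) - L * s\<^sup>2 / 2 + s^3 / 3 - 5 * (L/2 - s)^3 / 3 + 4 * (L/2 - s)^5 * inverse (L\<^sup>2)) * inverse (2 * L))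
     has_real_derivative ((s * (L - s)\<^sup>2 * exp s + (L - s) * s\<^sup>2 * exp (L - s)
        - L * s + s\<^sup>2 + 5 * x\<^sup>2 - 20 * x^4 * inverse (L\<^sup>2)) * inverse (2 * L))) (at s)"
    unfolding x_def divide_inverse
    by (rule derivative_eq_intros A DERIV_chain'[OF _ A] refl)+
       (simp add: algebra_simps eval_nat_numeral, use assms in \<open>simp add: field_simps\<close>)
  also have "(\<lambda>s. (A s - A (L - s) - L * s\<^sup>2 / 2 + s^3 / 3 - 5 * (L/2 - s)^3 / 3 + 4 * (L/2 - s)^5 * inverse (L\<^sup>2)) * inverse (2 * L))
      = ray_mass_primitive L"
    unfolding ray_mass_primitive_def Let_def A_def by (simp only: divide_inverse)
  finally have D: "(ray_mass_primitive L has_real_derivative (s * (L - s)\<^sup>2 * exp s + (L - s) * s\<^sup>2 * exp (L - s)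
        - L * s + s\<^sup>2 + 5 * x\<^sup>2 - 20 * x^4 * inverse (L\<^sup>2)) * inverse (2 * L)) (at s)" .
  \<comment> \<open>This uses s (L - s) = L^2/4 - x^2.\<close>
  have "5 * x\<^sup>2 - 20 * x^4 * inverse (L\<^sup>2) = 20 * s * (L - s) * (L/2 - s)\<^sup>2 / L\<^sup>2"
    using assms unfolding x_def by (simp add: field_simps eval_nat_numeral)
  hence eq: "(s * (L - s)\<^sup>2 * exp s + (L - s) * s\<^sup>2 * exp (L - s)
        - L * s + s\<^sup>2 + 5 * x\<^sup>2 - 20 * x^4 * inverse (L\<^sup>2)) =
     s * (L - s) * (s * exp (L - s) + (L - s) * exp s - 1 + 20 * (L/2 - s)\<^sup>2 / L\<^sup>2)"
    by (simp add: algebra_simps power2_eq_square)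
  have "s * (L - s) * B * inverse (2 * L) = s * ((L - s) / (2 * L) * B)" for B
    using assms by (simp add: field_simps)
  from D[unfolded eq this] show ?thesis unfolding ray_density_def .
qed

text \<open>The integral of s w(s) over [0, L], that is, the total mass of the segments. The value L
  gives their first coordinate, uniform on [0, L], the density 1 in the marginal equation. The mean
  condition on L enters here.\<close>

lemma ray_mass_primitive_diff:
  assumes L: "L > 0" and "(3 - L) * exp L = 3 + 2 * L"
  shows "ray_mass_primitive L L - ray_mass_primitive L 0 = L"
proof -
  have "exp L * L = 3 * exp L - 3 - 2 * L" using assms by (simp add: algebra_simps)
  thus ?thesis unfolding ray_mass_primitive_def Let_def using L
    by (simp add: field_simps eval_nat_numeral) algebra
qed

lemma ray_primitive_eq:
  assumes L: "L > 0"
  shows "ray_primitive L L = - 1"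
  by (simp add: ray_primitive_def)

lemma tri_density_nonneg:
  assumes "0 \<le> a" "a \<le> L_const"
  shows "0 \<le> tri_density L_const a"
proof -
  have "\<bar>L_const/2 - a\<bar> \<le> L_const/2" using assms by linarith
  from centred_density_nonneg[OF L_const_bounds exp_half_L_const_bounds this]
  show ?thesis using L_const_bounds by (simp add: tri_density_def Let_def)
qed

section \<open>Marginals\<close>

lemma finite_sum_measure:
  fixes N :: "nat \<Rightarrow> 'a measure"
  assumes "n > 0" and N: "\<And>i. i < n \<Longrightarrow> N i \<in> space (subprob_algebra B)"
  obtains S where "sets S = sets B"
    "\<And>f. f \<in> borel_measurable B \<Longrightarrow> (\<integral>\<^sup>+x. f x \<partial>S) = (\<Sum>i<n. \<integral>\<^sup>+x. f x \<partial>N i)"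
proof
  \<comment> \<open>Binding the family over the counting measure on its indices yields the sum;
    \<open>n > 0\<close> keeps the index space nonempty, so that the result has the sigma-algebra of
    \<open>B\<close>.\<close>
  let ?S = "count_space {..<n} \<bind> N"
  have N': "N \<in> count_space {..<n} \<rightarrow>\<^sub>M subprob_algebra B"
    using N by (simp add: measurable_count_space_eq1)
  show "sets ?S = sets B" using N' \<open>n > 0\<close> by (intro sets_bind_measurable) auto
  show "(\<integral>\<^sup>+x. f x \<partial>?S) = (\<Sum>i<n. \<integral>\<^sup>+x. f x \<partial>N i)" if "f \<in> borel_measurable B" for f
    using that N' by (simp add: nn_integral_bind nn_integral_count_space_finite)
qed

text \<open>The sum of the three rotated images of \<open>\<nu>\<close> has in each coordinate the
  sum of the three marginals of \<open>\<nu>\<close>, because a coordinate runs once through x, y, z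
  under the rotations. Invariance of \<open>K\<close> keeps its complement null.\<close>

lemma cyclic_symmetrization:
  fixes \<nu> :: "(real \<times> real \<times> real) measure" and K :: "(real \<times> real \<times> real) set"
  assumes sets_nu: "sets \<nu> = sets borel" and K: "K \<in> sets borel" "K \<subseteq> unit_cube"
    and K_cyc: "\<And>x y z. (x, y, z) \<in> K \<Longrightarrow> (y, z, x) \<in> K"
    and null: "emeasure \<nu> (- K) = 0"
    and marg: "\<And>F :: real \<Rightarrow> ennreal. F \<in> borel_measurable borel \<Longrightarrow>
      (\<integral>\<^sup>+(x, y, z). F x + F y + F z \<partial>\<nu>) = (\<integral>\<^sup>+x. F x * indicator {0..1} x \<partial>lborel)"
  shows "\<exists>\<mu>. stochastic_3_1 \<mu> \<and> emeasure \<mu> K = 1"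
proof -
  define g :: "nat \<Rightarrow> real \<times> real \<times> real \<Rightarrow> real \<times> real \<times> real" where
    "g = (\<lambda>i (x, y, z). if i = 0 then (x, y, z) else if i = 1 then (y, z, x) else (z, x, y))"
  have space_nu: "space \<nu> = UNIV" using sets_eq_imp_space_eq[OF sets_nu] by simp
  have g[measurable]: "g i \<in> \<nu> \<rightarrow>\<^sub>M borel" for i
  proof -
    have "g i \<in> borel \<rightarrow>\<^sub>M borel"
      by (cases "i = 0"; cases "i = 1")
         (auto simp: g_def split_beta' intro!: borel_measurable_continuous_onI continuous_intros)
    thus ?thesis using measurable_cong_sets[OF sets_nu refl] by blast
  qed
  have gK: "p \<in> K \<Longrightarrow> g i p \<in> K" for i p
    by (cases p) (auto simp: g_def dest: K_cyc)
  \<comment> \<open>The constant F = 1 forces \<open>\<nu>\<close> to have mass 1/3; the unweighted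
    sum of its images is therefore already normalized.\<close>
  have "3 * emeasure \<nu> (space \<nu>) = 1"
    using marg[of "\<lambda>_. 1"] by (simp add: split_beta')
  hence nu1: "emeasure \<nu> (space \<nu>) \<le> 1"
    using mult_right_mono[of 1 "3 :: ennreal" "emeasure \<nu> (space \<nu>)"] by simp
  have sp: "distr \<nu> borel (g i) \<in> space (subprob_algebra borel)" for i
    using nu1 by (auto simp: space_subprob_algebra intro!: subprob_spaceI simp: emeasure_distr)
  from finite_sum_measure[of 3 "\<lambda>i. distr \<nu> borel (g i)" borel] sp
  obtain S where sets_S: "sets S = sets borel"
    and S: "\<And>f. f \<in> borel_measurable borel \<Longrightarrow>
        (\<integral>\<^sup>+x. f x \<partial>S) = (\<Sum>i<3. \<integral>\<^sup>+x. f x \<partial>distr \<nu> borel (g i))"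
    by auto
  have space_S: "space S = UNIV" using sets_eq_imp_space_eq[OF sets_S] by simp
  have S_null: "emeasure S (- K) = 0"
  proof -
    have "emeasure \<nu> (g i -` (- K)) = 0" for i
    proof -
      have "emeasure \<nu> (g i -` (- K)) \<le> emeasure \<nu> (- K)"
        using gK K sets_nu by (intro emeasure_mono) (blast, auto)
      thus ?thesis using null by simp
    qed
    moreover have "emeasure S (- K) = (\<Sum>i<3. emeasure \<nu> (g i -` (- K)))"
      using S[of "indicator (- K)"] K sets_S by (simp add: emeasure_distr space_nu)
    ultimately show ?thesis by simp
  qed
  have S_marg: "(\<integral>\<^sup>+p. F (pr p) \<partial>S) = (\<integral>\<^sup>+x. F x * indicator {0..1} x \<partial>lborel)"
    if F[measurable]: "F \<in> borel_measurable borel" and pr: "pr \<in> {fst, fst \<circ> snd, snd \<circ> snd}"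
    for F :: "real \<Rightarrow> ennreal" and pr
  proof -
    have [measurable]: "pr \<in> borel \<rightarrow>\<^sub>M borel"
      using pr by (auto simp: comp_def intro!: borel_measurable_continuous_onI continuous_intros)
    have "(\<integral>\<^sup>+p. F (pr p) \<partial>S) = (\<Sum>i<3. \<integral>\<^sup>+p. F (pr (g i p)) \<partial>\<nu>)"
      by (subst S) (auto simp: nn_integral_distr)
    also have "\<dots> = (\<integral>\<^sup>+p. F (pr (g 0 p)) + F (pr (g 1 p)) + F (pr (g 2 p)) \<partial>\<nu>)"
      by (simp add: eval_nat_numeral lessThan_Suc nn_integral_add)
    also have "\<dots> = (\<integral>\<^sup>+(x, y, z). F x + F y + F z \<partial>\<nu>)"
      using pr by (intro nn_integral_cong) (auto simp: g_def split_beta' add_ac)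
    finally show ?thesis using marg[OF F] by simp
  qed
  have S_total: "emeasure S UNIV = 1"
    using S_marg[of "\<lambda>_. 1" fst] space_S by simp
  have S_K: "emeasure S K = 1"
  proof -
    have "emeasure S UNIV = emeasure S K + emeasure S (- K)"
      using K sets_S by (subst plus_emeasure) auto
    thus ?thesis using S_total S_null by simp
  qed
  \<comment> \<open>The sum lives on all of space, while \<open>stochastic_3_1\<close> requires the
    cube as underlying space; no mass is lost, since \<open>K\<close> lies in the cube.\<close>
  define \<mu> where "\<mu> = restrict_space S unit_cube"
  have cube: "unit_cube \<in> sets S" using sets_S by (simp add: borel_closed closed_Times)
  have cube1: "emeasure S unit_cube = 1"
    using S_K S_total K cube emeasure_mono[of K unit_cube S] emeasure_mono[of unit_cube UNIV S] sets_S
    by (auto intro: antisym)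
  have null_cube: "emeasure S (- unit_cube) = 0"
  proof -
    have "emeasure S (- unit_cube) \<le> emeasure S (- K)"
      using K sets_S by (intro emeasure_mono) auto
    thus ?thesis using S_null by simp
  qed
  have marginal: "distr \<mu> lebesgue01 pr = lebesgue01" if pr: "pr \<in> {fst, fst \<circ> snd, snd \<circ> snd}" for pr
  proof (rule measure_eqI)
    fix A assume "A \<in> sets (distr \<mu> lebesgue01 pr)"
    hence A: "A \<in> sets lebesgue01" by simp
    hence A': "A \<subseteq> {0..1}" "A \<in> sets borel" by (auto simp: sets_restrict_space_iff)
    have [measurable]: "pr \<in> borel \<rightarrow>\<^sub>M borel"
      using pr by (auto simp: comp_def intro!: borel_measurable_continuous_onI continuous_intros)
    have pr_m: "pr \<in> S \<rightarrow>\<^sub>M borel" by (simp cong: measurable_cong_sets add: sets_S)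
    have pr_mu: "pr \<in> \<mu> \<rightarrow>\<^sub>M lebesgue01"
      unfolding \<mu>_def using pr
      by (intro measurable_restrict_space2 measurable_restrict_space1)
         (use pr_m in \<open>auto simp: space_restrict_space\<close>)
    have "emeasure (distr \<mu> lebesgue01 pr) A = emeasure \<mu> (pr -` A \<inter> space \<mu>)"
      using A pr_mu by (simp add: emeasure_distr)
    also have "\<dots> = emeasure S (pr -` A \<inter> unit_cube)"
      unfolding \<mu>_def using cube by (subst emeasure_restrict_space) (auto simp: space_restrict_space space_S)
    also have "\<dots> = emeasure S (pr -` A)"
    proof (rule emeasure_eq_AE)
      have "AE p in S. p \<in> unit_cube"
        using null_cube cube sets.compl_sets[OF cube]
        by (subst AE_iff_measurable[of "- unit_cube"]) (auto simp: space_S Compl_eq_Diff_UNIV)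
      thus "AE p in S. p \<in> pr -` A \<inter> unit_cube \<longleftrightarrow> p \<in> pr -` A" by eventually_elim simp
    qed (use A' pr_m cube measurable_sets[OF pr_m] in \<open>auto simp: space_S\<close>)
    also have "\<dots> = (\<integral>\<^sup>+p. indicator (pr -` A) p \<partial>S)"
      using A' measurable_sets[OF pr_m, of A] by (simp add: space_S)
    also have "\<dots> = (\<integral>\<^sup>+p. indicator A (pr p) \<partial>S)"
      by (simp add: indicator_def)
    also have "\<dots> = (\<integral>\<^sup>+x. indicator A x * indicator {0..1} x \<partial>lborel)"
      using A' pr by (intro S_marg) auto
    also have "\<dots> = emeasure lborel (A \<inter> {0..1})"
      using A' by (simp flip: indicator_inter_arith)
    also have "\<dots> = emeasure lebesgue01 A"
      using A' by (simp add: emeasure_restrict_space Int_absorb2)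
    finally show "emeasure (distr \<mu> lebesgue01 pr) A = emeasure lebesgue01 A" .
  qed simp
  have "prob_space \<mu>"
    unfolding \<mu>_def using cube1 cube by (intro prob_spaceI) (simp add: emeasure_restrict_space space_restrict_space space_S)
  moreover have "sets \<mu> = sets (restrict_space borel unit_cube)"
    unfolding \<mu>_def by (rule sets_restrict_space_cong[OF sets_S])
  ultimately have "stochastic_3_1 \<mu>"
    using marginal[of fst] marginal[of "fst \<circ> snd"] marginal[of "snd \<circ> snd"]
    by (simp add: stochastic_3_1_def comp_def split_beta')
  moreover have "emeasure \<mu> K = 1"
    unfolding \<mu>_def using K cube S_K by (simp add: emeasure_restrict_space)
  ultimately show ?thesis by blast
qed

section \<open>Affine substitutions and the marginals of both families on the triangle\<close>

lemma nn_integral_add3: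
  fixes f g h :: "'a \<Rightarrow> ennreal"
  assumes "f \<in> borel_measurable M" "g \<in> borel_measurable M" "h \<in> borel_measurable M"
  shows "(\<integral>\<^sup>+x. f x + g x + h x \<partial>M) = (\<integral>\<^sup>+x. f x \<partial>M) + (\<integral>\<^sup>+x. g x \<partial>M) + (\<integral>\<^sup>+x. h x \<partial>M)"
  using assms by (simp add: nn_integral_add)

lemma ennreal_add_double:
  assumes "0 \<le> p" "0 \<le> q"
  shows "ennreal (p + 2 * q) = ennreal p + ennreal q + ennreal q"
proof -
  have "p + 2 * q = p + q + q" by simp
  thus ?thesis using assms by (simp only: ennreal_plus add_nonneg_nonneg)
qed

lemma nn_integral_reflect:
  fixes f :: "real \<Rightarrow> ennreal"
  assumes [measurable]: "f \<in> borel_measurable borel"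
  shows "(\<integral>\<^sup>+x. f (c - x) \<partial>lborel) = (\<integral>\<^sup>+x. f x \<partial>lborel)"
  using nn_integral_real_affine[of f "-1" c] by simp

text \<open>Substitution b = s u. With the factor s on the left the degenerate case s = 0 is
  included: both sides vanish.\<close>

lemma nn_integral_scale_unit:
  fixes H :: "real \<Rightarrow> ennreal"
  assumes [measurable]: "H \<in> borel_measurable borel" and s: "s \<ge> 0"
  shows "ennreal s * (\<integral>\<^sup>+u. H (s * u) * indicator {0..1} u \<partial>lborel)
       = (\<integral>\<^sup>+b. H b * indicator {0..s} b \<partial>lborel)"
proof (cases "s = 0")
  case True
  have "{0} \<in> null_sets (lborel :: real measure)" by auto
  hence "(\<integral>\<^sup>+b. H b * indicator {0} b \<partial>lborel) = 0" by (rule nn_integral_null_set)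
  thus ?thesis using True by simp
next
  case False
  hence "s > 0" using s by simp
  hence "(\<integral>\<^sup>+b. H b * indicator {0..s} b \<partial>lborel) = ennreal s * (\<integral>\<^sup>+u. H (s * u) * indicator {0..s} (s * u) \<partial>lborel)"
    using nn_integral_real_affine[of "\<lambda>b. H b * indicator {0..s} b" s 0] by simp
  also have "(\<integral>\<^sup>+u. H (s * u) * indicator {0..s} (s * u) \<partial>lborel) = (\<integral>\<^sup>+u. H (s * u) * indicator {0..1} u \<partial>lborel)"
    using \<open>s > 0\<close> by (intro nn_integral_cong) (auto simp: indicator_def zero_le_mult_iff)
  finally show ?thesis by simp
qed

text \<open>The line at distance a has b in an interval of length L - a, hence the term (L - a)
  phi(a). By Fubini the coordinate b has density \<open>\<Phi> (L - b) - \<Phi> 0\<close>, and the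
  reflection b -> L - a - b of each line gives the third coordinate the same density.\<close>

lemma triangle_marginals:
  fixes H :: "real \<Rightarrow> ennreal"
  assumes H[measurable]: "H \<in> borel_measurable borel" and [measurable]: "\<phi> \<in> borel_measurable borel"
    and nonneg: "\<And>a. 0 \<le> a \<Longrightarrow> a \<le> L \<Longrightarrow> 0 \<le> \<phi> a"
    and deriv: "\<And>a. (\<Phi> has_real_derivative \<phi> a) (at a)"
  shows "(\<integral>\<^sup>+a. \<integral>\<^sup>+b. (H a + H b + H (L - a - b)) *
            (ennreal (\<phi> a) * indicator {0..} a * indicator {0..} b * indicator {..L} (a + b)) \<partial>lborel \<partial>lborel)
       = (\<integral>\<^sup>+a. H a * ennreal ((L - a) * \<phi> a + 2 * (\<Phi> (L - a) - \<Phi> 0)) * indicator {0..L} a \<partial>lborel)"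
    (is "?lhs = ?rhs")
proof -
  \<comment> \<open>Half-plane indicators replace an interval for b that depends on a: they suit
    both orders of integration, and the weight is invariant under b -> L - a - b.\<close>
  let ?w = "\<lambda>a b. ennreal (\<phi> a) * indicator {0..} a * indicator {0..} b * (indicator {..L} (a + b) :: ennreal)"
  have Phi: "(\<integral>\<^sup>+a. ?w a b \<partial>lborel) = ennreal (\<Phi> (L - b) - \<Phi> 0) * indicator {0..L} b" for b
  proof (cases "0 \<le> b \<and> b \<le> L")
    case True
    have "(\<integral>\<^sup>+a. ?w a b \<partial>lborel) = (\<integral>\<^sup>+a. ennreal (\<phi> a) * indicator {0..L-b} a \<partial>lborel)"
      using True by (intro nn_integral_cong) (auto simp: indicator_def)
    also have "\<dots> = ennreal (\<Phi> (L - b) - \<Phi> 0)"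
      using True nonneg deriv by (intro nn_integral_FTC_Icc) auto
    finally show ?thesis using True by simp
  next
    case False
    hence "?w a b = 0" for a by (auto simp: indicator_def)
    hence "(\<lambda>a. ?w a b) = (\<lambda>_. 0)" by blast
    hence "(\<integral>\<^sup>+a. ?w a b \<partial>lborel) = 0" by (simp only: nn_integral_const) simp
    thus ?thesis using False by auto
  qed
  have 1: "(\<integral>\<^sup>+b. H a * ?w a b \<partial>lborel) = H a * ennreal ((L - a) * \<phi> a) * indicator {0..L} a" for a
  proof (cases "0 \<le> a \<and> a \<le> L")
    case True
    have "(\<integral>\<^sup>+b. H a * ?w a b \<partial>lborel) = (\<integral>\<^sup>+b. (H a * ennreal (\<phi> a)) * indicator {0..L-a} b \<partial>lborel)"
      using True by (intro nn_integral_cong) (auto simp: indicator_def)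
    also have "\<dots> = (H a * ennreal (\<phi> a)) * ennreal (L - a)"
      using True by (subst nn_integral_cmult_indicator) auto
    finally show ?thesis using True nonneg[of a] by (simp add: ennreal_mult mult_ac)
  next
    case False
    hence "(\<lambda>b. H a * ?w a b) = (\<lambda>_. 0)" by (auto simp: indicator_def fun_eq_iff)
    hence "(\<integral>\<^sup>+b. H a * ?w a b \<partial>lborel) = 0" by (simp only: nn_integral_const) simp
    thus ?thesis using False by auto
  qed
  have 2: "(\<integral>\<^sup>+a. \<integral>\<^sup>+b. H b * ?w a b \<partial>lborel \<partial>lborel)
      = (\<integral>\<^sup>+b. H b * ennreal (\<Phi> (L - b) - \<Phi> 0) * indicator {0..L} b \<partial>lborel)"
  proof -
    have "(\<integral>\<^sup>+a. \<integral>\<^sup>+b. H b * ?w a b \<partial>lborel \<partial>lborel) = (\<integral>\<^sup>+b. \<integral>\<^sup>+a. H b * ?w a b \<partial>lborel \<partial>lborel)"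
      by (rule lborel_pair.Fubini') measurable
    moreover have "(\<integral>\<^sup>+a. H b * ?w a b \<partial>lborel) = H b * ennreal (\<Phi> (L - b) - \<Phi> 0) * indicator {0..L} b" for b
    proof -
      have "(\<integral>\<^sup>+a. H b * ?w a b \<partial>lborel) = H b * (\<integral>\<^sup>+a. ?w a b \<partial>lborel)"
        by (rule nn_integral_cmult) measurable
      thus ?thesis unfolding Phi by (simp only: mult.assoc)
    qed
    ultimately show ?thesis by simp
  qed
  have 3: "(\<integral>\<^sup>+b. H (L - a - b) * ?w a b \<partial>lborel) = (\<integral>\<^sup>+b. H b * ?w a b \<partial>lborel)" for a
  proof -
    have "(\<integral>\<^sup>+b. H b * ?w a b \<partial>lborel) = (\<integral>\<^sup>+b. H (L - a - b) * ?w a (L - a - b) \<partial>lborel)"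
      by (rule nn_integral_reflect[symmetric]) measurable
    also have "\<dots> = (\<integral>\<^sup>+b. H (L - a - b) * ?w a b \<partial>lborel)"
      by (intro nn_integral_cong) (auto simp: indicator_def)
    finally show ?thesis by simp
  qed
  have mono: "0 \<le> \<Phi> (L - a) - \<Phi> 0" if "0 \<le> a" "a \<le> L" for a
    using DERIV_nonneg_imp_nondecreasing[of 0 "L - a" \<Phi>] that deriv nonneg by force
  define U where "U = (\<lambda>a. H a * ennreal ((L - a) * \<phi> a) * indicator {0..L} a)"
  define V where "V = (\<lambda>a. H a * ennreal (\<Phi> (L - a) - \<Phi> 0) * indicator {0..L} a)"
  define I where "I = (\<lambda>a. \<integral>\<^sup>+b. H b * ?w a b \<partial>lborel)"
  have Phi_m[measurable]: "\<Phi> \<in> borel_measurable borel"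
    using deriv by (intro borel_measurable_continuous_onI) (blast intro: continuous_at_imp_continuous_on DERIV_isCont)
  have [measurable]: "U \<in> borel_measurable borel" "V \<in> borel_measurable borel"
    unfolding U_def V_def by measurable
  have [measurable]: "I \<in> borel_measurable borel"
    unfolding I_def by measurable
  have "(\<integral>\<^sup>+b. (H a + H b + H (L - a - b)) * ?w a b \<partial>lborel) = U a + I a + I a" for a
  proof -
    have "(\<integral>\<^sup>+b. (H a + H b + H (L - a - b)) * ?w a b \<partial>lborel)
      = (\<integral>\<^sup>+b. H a * ?w a b + H b * ?w a b + H (L - a - b) * ?w a b \<partial>lborel)"
      by (simp only: distrib_right)
    also have "\<dots> = (\<integral>\<^sup>+b. H a * ?w a b \<partial>lborel) + (\<integral>\<^sup>+b. H b * ?w a b \<partial>lborel)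
        + (\<integral>\<^sup>+b. H (L - a - b) * ?w a b \<partial>lborel)"
      by (rule nn_integral_add3) measurable
    finally show ?thesis by (simp only: 1 3 U_def I_def)
  qed
  hence "?lhs = (\<integral>\<^sup>+a. U a + I a + I a \<partial>lborel)" by (simp only:)
  also have "\<dots> = (\<integral>\<^sup>+a. U a \<partial>lborel) + (\<integral>\<^sup>+a. I a \<partial>lborel) + (\<integral>\<^sup>+a. I a \<partial>lborel)"
    by (rule nn_integral_add3) measurable
  also have "\<dots> = (\<integral>\<^sup>+a. U a \<partial>lborel) + (\<integral>\<^sup>+a. V a \<partial>lborel) + (\<integral>\<^sup>+a. V a \<partial>lborel)"
    using 2 by (simp only: I_def V_def)
  also have "\<dots> = (\<integral>\<^sup>+a. U a + V a + V a \<partial>lborel)"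
    by (rule nn_integral_add3[symmetric]) measurable
  also have "\<dots> = ?rhs"
  proof -
    have "U a + V a + V a = H a * ennreal ((L - a) * \<phi> a + 2 * (\<Phi> (L - a) - \<Phi> 0)) * indicator {0..L} a" for a
    proof (cases "0 \<le> a \<and> a \<le> L")
      case True
      hence "ennreal ((L - a) * \<phi> a + 2 * (\<Phi> (L - a) - \<Phi> 0)) =
        ennreal ((L - a) * \<phi> a) + ennreal (\<Phi> (L - a) - \<Phi> 0) + ennreal (\<Phi> (L - a) - \<Phi> 0)"
        using mono[of a] nonneg[of a] by (intro ennreal_add_double) auto
      thus ?thesis using True by (simp only: U_def V_def distrib_left distrib_right)
    qed (auto simp: U_def V_def)
    thus ?thesis by (simp only:)
  qed
  finally show ?thesis .
qed

text \<open>The segment runs from the vertex (L, 0, 0) at u = 0 to (0, s, L - s) at u = 1. Its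
  second coordinate is uniform on [0, s], so mass s w(s) means density w(s) there, and integration
  over s \<ge> b gives the integral of w over [b, L]. The symmetry of s w(s) gives the third
  coordinate the same density.\<close>

lemma ray_marginals:
  fixes H :: "real \<Rightarrow> ennreal"
  assumes H[measurable]: "H \<in> borel_measurable borel" and L: "L \<ge> 0"
    and w[measurable]: "w \<in> borel_measurable borel"
    and nonneg: "\<And>s. 0 \<le> s \<Longrightarrow> s \<le> L \<Longrightarrow> 0 \<le> w s"
    and reflect: "\<And>s. (L - s) * w (L - s) = s * w s"
    and mass: "(\<integral>\<^sup>+s. ennreal (s * w s) * indicator {0..L} s \<partial>lborel) = ennreal L"
    and deriv: "\<And>s. (W has_real_derivative 2 * w s) (at s)"
  shows "(\<integral>\<^sup>+s. \<integral>\<^sup>+u. (H (L * (1 - u)) + H (s * u) + H ((L - s) * u)) *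
            (ennreal (s * w s) * indicator {0..L} s * indicator {0..1} u) \<partial>lborel \<partial>lborel)
       = (\<integral>\<^sup>+a. H a * ennreal (1 + (W L - W a)) * indicator {0..L} a \<partial>lborel)"
    (is "?lhs = ?rhs")
proof -
  define m where "m = (\<lambda>s. ennreal (s * w s) * indicator {0..L} s)"
  have m[measurable]: "m \<in> borel_measurable borel" unfolding m_def by measurable
  have m_reflect: "m (L - s) = m s" for s
    by (auto simp: m_def reflect indicator_def)
  define I where "I = (\<lambda>s. \<integral>\<^sup>+u. H (s * u) * (m s * indicator {0..1} u) \<partial>lborel)"
  define J where "J = (\<lambda>s. \<integral>\<^sup>+u. H ((L - s) * u) * (m s * indicator {0..1} u) \<partial>lborel)"
  define K where "K = (\<lambda>s. \<integral>\<^sup>+u. H (L * (1 - u)) * (m s * indicator {0..1} u) \<partial>lborel)"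
  have [measurable]: "I \<in> borel_measurable borel" "J \<in> borel_measurable borel" "K \<in> borel_measurable borel"
    unfolding I_def J_def K_def by measurable
  define V where "V = (\<lambda>b. H b * ennreal ((W L - W b) / 2) * indicator {0..L} b)"
  have [measurable]: "W \<in> borel_measurable borel"
    using deriv by (intro borel_measurable_continuous_onI) (blast intro: continuous_at_imp_continuous_on DERIV_isCont)
  have [measurable]: "V \<in> borel_measurable borel" unfolding V_def by measurable
  have mono: "0 \<le> W L - W a" if "0 \<le> a" "a \<le> L" for a
    using DERIV_nonneg_imp_nondecreasing[of a L W] that deriv nonneg by force
  have K: "(\<integral>\<^sup>+s. K s \<partial>lborel) = (\<integral>\<^sup>+a. H a * indicator {0..L} a \<partial>lborel)"
  proof -
    have "K s = (\<integral>\<^sup>+u. H (L * u) * indicator {0..1} u \<partial>lborel) * m s" for s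
    proof -
      have "K s = (\<integral>\<^sup>+u. (H (L * (1 - u)) * indicator {0..1} (1 - u)) * m s \<partial>lborel)"
        unfolding K_def by (intro nn_integral_cong) (auto simp: indicator_def)
      also have "\<dots> = (\<integral>\<^sup>+u. H (L * (1 - u)) * indicator {0..1} (1 - u) \<partial>lborel) * m s"
        by (rule nn_integral_multc) measurable
      also have "(\<integral>\<^sup>+u. H (L * (1 - u)) * indicator {0..1} (1 - u) \<partial>lborel)
          = (\<integral>\<^sup>+u. H (L * u) * indicator {0..1} u \<partial>lborel)"
        by (rule nn_integral_reflect) measurable
      finally show ?thesis .
    qed
    hence "(\<integral>\<^sup>+s. K s \<partial>lborel) = (\<integral>\<^sup>+u. H (L * u) * indicator {0..1} u \<partial>lborel) * (\<integral>\<^sup>+s. m s \<partial>lborel)"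
      by (simp add: nn_integral_cmult)
    also have "\<dots> = ennreal L * (\<integral>\<^sup>+u. H (L * u) * indicator {0..1} u \<partial>lborel)"
      using mass by (simp add: m_def mult.commute)
    finally show ?thesis using L by (simp add: nn_integral_scale_unit)
  qed
  have J: "(\<integral>\<^sup>+s. J s \<partial>lborel) = (\<integral>\<^sup>+s. I s \<partial>lborel)"
  proof -
    have "J (L - s) = I s" for s by (simp add: I_def J_def m_reflect)
    thus ?thesis using nn_integral_reflect[of J L] by simp
  qed
  have I: "(\<integral>\<^sup>+s. I s \<partial>lborel) = (\<integral>\<^sup>+b. V b \<partial>lborel)"
  proof -
    \<comment> \<open>The integrand after b = s u: the factor s is used up by db = s du, and the
      region is 0 \<le> b \<le> s \<le> L.\<close>
    let ?g = "\<lambda>s b. H b * (ennreal (w s) * indicator {0..} b * indicator {..L} s * indicator {0..} (s - b))"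
    have "I s = (\<integral>\<^sup>+b. ?g s b \<partial>lborel)" for s
    proof (cases "0 \<le> s \<and> s \<le> L")
      case True
      have "I s = (\<integral>\<^sup>+u. (H (s * u) * indicator {0..1} u) * m s \<partial>lborel)"
        unfolding I_def by (intro nn_integral_cong) (simp add: mult_ac)
      also have "\<dots> = (\<integral>\<^sup>+u. H (s * u) * indicator {0..1} u \<partial>lborel) * m s"
        by (rule nn_integral_multc) measurable
      also have "m s = ennreal s * ennreal (w s)"
        using True nonneg[of s] by (simp add: m_def ennreal_mult)
      also have "(\<integral>\<^sup>+u. H (s * u) * indicator {0..1} u \<partial>lborel) * (ennreal s * ennreal (w s))
         = (ennreal s * (\<integral>\<^sup>+u. H (s * u) * indicator {0..1} u \<partial>lborel)) * ennreal (w s)"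
        by (simp only: mult_ac)
      also have "\<dots> = (\<integral>\<^sup>+b. H b * indicator {0..s} b \<partial>lborel) * ennreal (w s)"
        using True by (subst nn_integral_scale_unit) auto
      also have "\<dots> = (\<integral>\<^sup>+b. H b * indicator {0..s} b * ennreal (w s) \<partial>lborel)"
        by (rule nn_integral_multc[symmetric]) measurable
      also have "\<dots> = (\<integral>\<^sup>+b. ?g s b \<partial>lborel)"
        using True by (intro nn_integral_cong) (auto simp: indicator_def)
      finally show ?thesis .
    next
      case False
      hence "(\<lambda>b. ?g s b) = (\<lambda>_. 0)" by (auto simp: indicator_def fun_eq_iff)
      hence "(\<integral>\<^sup>+b. ?g s b \<partial>lborel) = 0" by (simp only: nn_integral_const) simp
      moreover have "I s = 0" using False by (auto simp: I_def m_def)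
      ultimately show ?thesis by simp
    qed
    hence "(\<integral>\<^sup>+s. I s \<partial>lborel) = (\<integral>\<^sup>+s. \<integral>\<^sup>+b. ?g s b \<partial>lborel \<partial>lborel)" by (simp only:)
    also have "\<dots> = (\<integral>\<^sup>+b. \<integral>\<^sup>+s. ?g s b \<partial>lborel \<partial>lborel)"
      by (rule lborel_pair.Fubini') measurable
    also have "\<dots> = (\<integral>\<^sup>+b. V b \<partial>lborel)"
    proof -
      have "(\<integral>\<^sup>+s. ?g s b \<partial>lborel) = V b" for b
      proof (cases "0 \<le> b \<and> b \<le> L")
        case True
        have "(\<integral>\<^sup>+s. ?g s b \<partial>lborel) = (\<integral>\<^sup>+s. H b * (ennreal (w s) * indicator {b..L} s) \<partial>lborel)"
          using True by (intro nn_integral_cong) (auto simp: indicator_def)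
        also have "\<dots> = H b * (\<integral>\<^sup>+s. ennreal (w s) * indicator {b..L} s \<partial>lborel)"
          by (rule nn_integral_cmult) measurable
        also have "(\<integral>\<^sup>+s. ennreal (w s) * indicator {b..L} s \<partial>lborel) = ennreal (W L / 2 - W b / 2)"
          using True nonneg DERIV_cdivide[OF deriv, where c = 2] by (intro nn_integral_FTC_Icc) auto
        finally show ?thesis using True by (simp add: V_def diff_divide_distrib)
      next
        case False
        hence "(\<lambda>s. ?g s b) = (\<lambda>_. 0)" by (auto simp: indicator_def fun_eq_iff)
        hence "(\<integral>\<^sup>+s. ?g s b \<partial>lborel) = 0" by (simp only: nn_integral_const) simp
        moreover have "V b = 0" using False by (auto simp: V_def)
        ultimately show ?thesis by simp
      qed
      thus ?thesis by (simp only:)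
    qed
    finally show ?thesis .
  qed
  have "(\<integral>\<^sup>+u. (H (L * (1 - u)) + H (s * u) + H ((L - s) * u)) * (m s * indicator {0..1} u) \<partial>lborel)
      = K s + I s + J s" for s
  proof -
    have "(\<integral>\<^sup>+u. (H (L * (1 - u)) + H (s * u) + H ((L - s) * u)) * (m s * indicator {0..1} u) \<partial>lborel)
      = (\<integral>\<^sup>+u. H (L * (1 - u)) * (m s * indicator {0..1} u) + H (s * u) * (m s * indicator {0..1} u)
         + H ((L - s) * u) * (m s * indicator {0..1} u) \<partial>lborel)"
      by (simp only: distrib_right)
    also have "\<dots> = K s + I s + J s"
      unfolding K_def I_def J_def by (rule nn_integral_add3) measurable
    finally show ?thesis .
  qed
  hence "?lhs = (\<integral>\<^sup>+s. K s + I s + J s \<partial>lborel)" by (simp only: m_def)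
  also have "\<dots> = (\<integral>\<^sup>+s. K s \<partial>lborel) + (\<integral>\<^sup>+s. I s \<partial>lborel) + (\<integral>\<^sup>+s. J s \<partial>lborel)"
    by (rule nn_integral_add3) measurable
  also have "\<dots> = (\<integral>\<^sup>+a. H a * indicator {0..L} a \<partial>lborel) + (\<integral>\<^sup>+b. V b \<partial>lborel) + (\<integral>\<^sup>+b. V b \<partial>lborel)"
    by (simp only: K I J)
  also have "\<dots> = (\<integral>\<^sup>+a. H a * indicator {0..L} a + V a + V a \<partial>lborel)"
    by (rule nn_integral_add3[symmetric]) measurable
  also have "\<dots> = ?rhs"
  proof -
    have "H a * indicator {0..L} a + V a + V a = H a * ennreal (1 + (W L - W a)) * indicator {0..L} a" for a
    proof (cases "0 \<le> a \<and> a \<le> L")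
      case True
      define d where "d = (W L - W a) / 2"
      have d: "W L - W a = 2 * d" "0 \<le> d" using True mono[of a] by (auto simp: d_def)
      have "ennreal (1 + (W L - W a)) = 1 + ennreal d + ennreal d"
        using ennreal_add_double[of 1 d] d by simp
      thus ?thesis using True by (simp add: V_def distrib_left d_def)
    qed (auto simp: V_def)
    thus ?thesis by (simp only:)
  qed
  finally show ?thesis .
qed

section \<open>Images of plane densities and the exponential substitution\<close>

lemma nn_integral_distr_density_plane:
  fixes w :: "real \<times> real \<Rightarrow> ennreal" and G :: "real \<times> real \<Rightarrow> 'b::topological_space"
  assumes [measurable]: "w \<in> borel_measurable borel" "G \<in> borel_measurable borel" "f \<in> borel_measurable borel"
  shows "(\<integral>\<^sup>+p. f p \<partial>distr (density lborel (\<lambda>p. c * w p)) borel G)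
    = c * (\<integral>\<^sup>+a. \<integral>\<^sup>+b. f (G (a, b)) * w (a, b) \<partial>lborel \<partial>lborel)"
proof -
  have "(\<integral>\<^sup>+p. f p \<partial>distr (density lborel (\<lambda>p. c * w p)) borel G) = (\<integral>\<^sup>+p. c * (f (G p) * w p) \<partial>lborel)"
    by (simp add: nn_integral_distr nn_integral_density mult_ac)
  also have "\<dots> = c * (\<integral>\<^sup>+p. f (G p) * w p \<partial>lborel)"
    by (rule nn_integral_cmult) measurable
  also have "(\<integral>\<^sup>+p. f (G p) * w p \<partial>lborel) = (\<integral>\<^sup>+p. f (G p) * w p \<partial>(lborel \<Otimes>\<^sub>M lborel))"
    by (simp add: lborel_prod)
  also have "\<dots> = (\<integral>\<^sup>+a. \<integral>\<^sup>+b. f (G (a, b)) * w (a, b) \<partial>lborel \<partial>lborel)"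
    by (rule lborel.nn_integral_fst[symmetric])
       (simp add: measurable_cong_sets[OF arg_cong[OF lborel_prod, of sets] refl])
  finally show ?thesis .
qed

text \<open>First x = l e^u, with Jacobian x itself, then the reflection u = L - a.\<close>

lemma nn_integral_exp_reflect:
  fixes F :: "real \<Rightarrow> ennreal"
  assumes [measurable]: "F \<in> borel_measurable borel" and "l > 0" "L > 0"
  shows "(\<integral>\<^sup>+a. F (l * exp (L - a)) * ennreal (l * exp (L - a)) * indicator {0..L} a \<partial>lborel)
    = (\<integral>\<^sup>+x. F x * indicator {l..l * exp L} x \<partial>lborel)"
proof -
  define g where "g = (\<lambda>u. l * exp u)"
  have "(\<integral>\<^sup>+x. F x * indicator {g 0..g L} x \<partial>lborel) = (\<integral>\<^sup>+u. F (g u) * ennreal (g u) * indicator {0..L} u \<partial>lborel)"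
    using assms(2,3) unfolding g_def
    by (intro nn_integral_substitution_aux) (auto intro!: derivative_eq_intros continuous_intros)
  also have "\<dots> = (\<integral>\<^sup>+a. F (g (L - a)) * ennreal (g (L - a)) * indicator {0..L} (L - a) \<partial>lborel)"
    unfolding g_def by (rule nn_integral_reflect[symmetric]) measurable
  also have "\<dots> = (\<integral>\<^sup>+a. F (g (L - a)) * ennreal (g (L - a)) * indicator {0..L} a \<partial>lborel)"
    by (intro nn_integral_cong) (auto simp: indicator_def)
  finally show ?thesis by (simp add: g_def)
qed

section \<open>The measure on M\<close>

lemma M_set_closed: "closed M_set"
proof -
  have eqs: "M_x = {p. fst p \<in> {0..l_const} \<and> fst (snd p) = 1 - 2 * fst p \<and> snd (snd p) = 1 - 2 * fst p}"
    "M_y = {p. fst (snd p) \<in> {0..l_const} \<and> fst p = 1 - 2 * fst (snd p) \<and> snd (snd p) = 1 - 2 * fst (snd p)}"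
    "M_z = {p. snd (snd p) \<in> {0..l_const} \<and> fst p = 1 - 2 * snd (snd p) \<and> fst (snd p) = 1 - 2 * snd (snd p)}"
    "M_2 = {p. fst p \<in> {l_const..r_const} \<and> fst (snd p) \<in> {l_const..r_const} \<and> snd (snd p) \<in> {l_const..r_const}
       \<and> fst p * fst (snd p) * snd (snd p) = l_const * r_const\<^sup>2}"
    by (auto simp: M_x_def M_y_def M_z_def M_2_def)
  have "closed M_x" "closed M_y" "closed M_z" "closed M_2"
    unfolding eqs atLeastAtMost_iff
    by (intro closed_Collect_conj closed_Collect_le closed_Collect_eq continuous_intros)+
  thus ?thesis by (auto simp: M_set_def)
qed

lemma M_set_subset_cube: "M_set \<subseteq> unit_cube"
  using l_const_bounds by (auto simp: M_set_def M_x_def M_y_def M_z_def M_2_def r_const_def)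

lemma M_set_cyclic: "(x, y, z) \<in> M_set \<Longrightarrow> (y, z, x) \<in> M_set"
  by (auto simp: M_set_def M_x_def M_y_def M_z_def M_2_def mult_ac)

text \<open>The inverse of a = ln (r/x), written with r = l e^L: a = 0 corresponds to r and a = L to
  l.\<close>

definition log_chart :: "real \<Rightarrow> real" where "log_chart a = l_const * exp (L_const - a)"

lemma log_chart_M_2:
  assumes "0 \<le> a" "0 \<le> b" "0 \<le> c" "a + b + c = L_const"
  shows "(log_chart a, log_chart b, log_chart c) \<in> M_2"
proof -
  have range: "log_chart t \<in> {l_const..r_const}" if "0 \<le> t" "t \<le> L_const" for t
    using that l_const_pos by (auto simp: log_chart_def simp flip: l_const_exp)
  have "log_chart a * log_chart b * log_chart c = l_const ^ 3 * exp ((L_const - a) + (L_const - b) + (L_const - c))"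
    by (simp only: log_chart_def exp_add power3_eq_cube mult_ac)
  also have "(L_const - a) + (L_const - b) + (L_const - c) = L_const + L_const" using assms by simp
  also have "l_const ^ 3 * exp (L_const + L_const) = l_const * r_const\<^sup>2"
    unfolding l_const_exp[symmetric] by (simp only: exp_add power3_eq_cube power2_eq_square mult_ac)
  finally show ?thesis using assms range by (auto simp: M_2_def)
qed

text \<open>Only the segment \<open>M_x\<close> is charged; the cyclic symmetrization supplies
  \<open>M_y\<close> and \<open>M_z\<close>.\<close>

definition seg_measure :: "(real \<times> real \<times> real) measure" where
  "seg_measure = distr (density lborel (indicator {0..l_const})) borel (\<lambda>t. (t, 1 - 2 * t, 1 - 2 * t))"

definition tri_weight :: "real \<times> real \<Rightarrow> ennreal" where
  "tri_weight = (\<lambda>(a, b). ennreal (tri_density L_const a) * indicator {0..} a * indicator {0..} b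
     * indicator {..L_const} (a + b))"

definition tri_map :: "real \<times> real \<Rightarrow> real \<times> real \<times> real" where
  "tri_map = (\<lambda>(a, b). (log_chart a, log_chart b, log_chart (L_const - a - b)))"

definition ray_weight :: "real \<times> real \<Rightarrow> ennreal" where
  "ray_weight = (\<lambda>(s, u). ennreal (s * ray_density L_const s) * indicator {0..L_const} s * indicator {0..1} u)"

definition ray_map :: "real \<times> real \<Rightarrow> real \<times> real \<times> real" where
  "ray_map = (\<lambda>(s, u). (log_chart (L_const * (1 - u)), log_chart (s * u), log_chart ((L_const - s) * u)))"

text \<open>The densities are normalized to the total marginal e^(L - a); the factor
  \<open>l_const\<close> converts this to l e^(L - a), which is Lebesgue measure in the coordinate
  a.\<close>

definition tri_measure :: "(real \<times> real \<times> real) measure" where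
  "tri_measure = distr (density lborel (\<lambda>p. ennreal l_const * tri_weight p)) borel tri_map"

definition ray_measure :: "(real \<times> real \<times> real) measure" where
  "ray_measure = distr (density lborel (\<lambda>p. ennreal l_const * ray_weight p)) borel ray_map"

section \<open>Measurability of the components\<close>

lemma continuous_tri_density: "continuous_on UNIV (tri_density L_const)"
  unfolding tri_density_def Let_def using L_const_bounds by (auto intro!: continuous_intros)

lemma continuous_ray_density: "continuous_on UNIV (ray_density L_const)"
  unfolding ray_density_def using L_const_bounds by (auto intro!: continuous_intros)

lemma borel_measurable_tri_density[measurable]: "tri_density L_const \<in> borel_measurable borel"
  by (rule borel_measurable_continuous_onI[OF continuous_tri_density])

lemma borel_measurable_ray_density[measurable]: "ray_density L_const \<in> borel_measurable borel"
  by (rule borel_measurable_continuous_onI[OF continuous_ray_density])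

lemma continuous_log_chart[continuous_intros]:
  "continuous_on S f \<Longrightarrow> continuous_on S (\<lambda>x. log_chart (f x))"
  unfolding log_chart_def by (intro continuous_intros)

lemma borel_measurable_log_chart[measurable]: "log_chart \<in> borel_measurable borel"
  by (intro borel_measurable_continuous_onI continuous_intros)

lemma borel_measurable_maps[measurable]:
  "tri_map \<in> borel_measurable borel" "ray_map \<in> borel_measurable borel"
  unfolding tri_map_def ray_map_def split_beta'
  by (intro borel_measurable_continuous_onI continuous_intros)+

lemma borel_measurable_weights[measurable]:
  "tri_weight \<in> borel_measurable borel" "ray_weight \<in> borel_measurable borel"
  unfolding tri_weight_def ray_weight_def split_beta' borel_prod[symmetric] by measurable

lemma sum_marginals_borel[measurable]:
  assumes "F \<in> borel_measurable borel"
  shows "(\<lambda>(x, y, z). F x + F y + F z :: ennreal) \<in> borel_measurable (borel :: (real \<times> real \<times> real) measure)"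
  using assms unfolding split_beta' borel_prod[symmetric] by measurable

section \<open>Summed marginals of the components\<close>

lemma seg_marginals:
  fixes F :: "real \<Rightarrow> ennreal"
  assumes F[measurable]: "F \<in> borel_measurable borel"
  shows "(\<integral>\<^sup>+(x, y, z). F x + F y + F z \<partial>seg_measure)
     = (\<integral>\<^sup>+x. F x * indicator {0..l_const} x \<partial>lborel) + (\<integral>\<^sup>+x. F x * indicator {r_const..1} x \<partial>lborel)"
proof -
  have [measurable]: "(\<lambda>t. (t, 1 - 2 * t, 1 - 2 * t)) \<in> (borel :: real measure) \<rightarrow>\<^sub>M (borel :: (real \<times> real \<times> real) measure)"
    by (intro borel_measurable_continuous_onI continuous_intros)
  let ?I = "indicator {0..l_const} :: real \<Rightarrow> ennreal"
  have "(\<integral>\<^sup>+(x, y, z). F x + F y + F z \<partial>seg_measure)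
      = (\<integral>\<^sup>+t. ?I t * (F t + F (1 - 2 * t) + F (1 - 2 * t)) \<partial>lborel)"
    unfolding seg_measure_def using sum_marginals_borel[OF F]
    by (subst nn_integral_distr; (subst nn_integral_density)?) auto
  also have "\<dots> = (\<integral>\<^sup>+t. F t * ?I t + F (1 - 2 * t) * ?I t + F (1 - 2 * t) * ?I t \<partial>lborel)"
    by (simp only: distrib_left mult.commute)
  also have "\<dots> = (\<integral>\<^sup>+t. F t * ?I t \<partial>lborel) + (\<integral>\<^sup>+t. F (1 - 2 * t) * ?I t \<partial>lborel) + (\<integral>\<^sup>+t. F (1 - 2 * t) * ?I t \<partial>lborel)"
    by (rule nn_integral_add3) measurable
  also have "\<dots> = (\<integral>\<^sup>+t. F t * ?I t \<partial>lborel) + 2 * (\<integral>\<^sup>+t. F (1 - 2 * t) * ?I t \<partial>lborel)"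
    by (simp only: mult_2 add.assoc)
  \<comment> \<open>Two coordinates equal 1 - 2 t, each with density 1/2 on [r, 1]; the factor 2
    cancels the Jacobian.\<close>
  also have "2 * (\<integral>\<^sup>+t. F (1 - 2 * t) * ?I t \<partial>lborel) = (\<integral>\<^sup>+x. F x * indicator {r_const..1} x \<partial>lborel)"
  proof -
    have "(\<integral>\<^sup>+x. F x * indicator {r_const..1} x \<partial>lborel)
       = 2 * (\<integral>\<^sup>+t. F (1 - 2 * t) * indicator {r_const..1} (1 - 2 * t) \<partial>lborel)"
      using nn_integral_real_affine[of "\<lambda>x. F x * indicator {r_const..1} x" "-2" 1] by simp
    also have "(\<integral>\<^sup>+t. F (1 - 2 * t) * indicator {r_const..1} (1 - 2 * t) \<partial>lborel) = (\<integral>\<^sup>+t. F (1 - 2 * t) * ?I t \<partial>lborel)"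
      by (intro nn_integral_cong) (auto simp: indicator_def r_const_def)
    finally show ?thesis by simp
  qed
  finally show ?thesis .
qed

text \<open>In the coordinate a the lines contribute \<open>?P\<close> and the segments
  \<open>?Q\<close>, with sum e^(L - a). Both are nonnegative on [0, L], so the identity survives
  the passage to \<open>ennreal\<close>; the chart then carries it to Lebesgue measure on
  [l, r].\<close>

lemma tri_ray_marginals:
  fixes F :: "real \<Rightarrow> ennreal"
  assumes F[measurable]: "F \<in> borel_measurable borel"
  shows "(\<integral>\<^sup>+(x, y, z). F x + F y + F z \<partial>tri_measure) + (\<integral>\<^sup>+(x, y, z). F x + F y + F z \<partial>ray_measure)
     = (\<integral>\<^sup>+x. F x * indicator {l_const..r_const} x \<partial>lborel)"
proof -
  have L: "0 < L_const" "1 \<le> L_const" using L_const_bounds by auto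
  let ?H = "\<lambda>a. F (log_chart a)"
  let ?P = "\<lambda>a. (L_const - a) * tri_density L_const a + 2 * (tri_primitive L_const (L_const - a) - tri_primitive L_const 0)"
  let ?Q = "\<lambda>a. 1 + (ray_primitive L_const L_const - ray_primitive L_const a)"
  have P: "0 \<le> ?P a" if "0 \<le> a" "a \<le> L_const" for a
  proof -
    have "tri_primitive L_const 0 \<le> tri_primitive L_const (L_const - a)"
    proof (rule DERIV_nonneg_imp_nondecreasing[where f = "tri_primitive L_const"])
      fix t assume "0 \<le> t" "t \<le> L_const - a"
      thus "\<exists>y. (tri_primitive L_const has_real_derivative y) (at t) \<and> 0 \<le> y"
        using that tri_primitive_deriv[OF L(1), of t] tri_density_nonneg[of t] by force
    qed (use that in simp)
    thus ?thesis using that tri_density_nonneg[of a] by simp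
  qed
  have Q: "0 \<le> ?Q a" if "0 \<le> a" "a \<le> L_const" for a
  proof -
    have "ray_primitive L_const a \<le> ray_primitive L_const L_const"
    proof (rule DERIV_nonneg_imp_nondecreasing[where f = "ray_primitive L_const"])
      fix t assume "a \<le> t" "t \<le> L_const"
      thus "\<exists>y. (ray_primitive L_const has_real_derivative y) (at t) \<and> 0 \<le> y"
        using that ray_primitive_deriv[OF L(1), of t] ray_density_nonneg[OF L(2), of t] by force
    qed (use that in simp)
    thus ?thesis by simp
  qed
  have PQ: "?P a + ?Q a = exp (L_const - a)" for a
    unfolding ray_primitive_eq[OF L(1)] by (simp add: ray_primitive_def)
  have mass: "(\<integral>\<^sup>+s. ennreal (s * ray_density L_const s) * indicator {0..L_const} s \<partial>lborel) = ennreal L_const"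
    using ray_mass_primitive_diff[OF L(1) L_const_equation] L ray_density_nonneg[OF L(2)] ray_mass_primitive_deriv[OF L(1)]
    by (subst nn_integral_FTC_Icc) auto
  have split: "(case (tri_map (a, b)) of (x, y, z) \<Rightarrow> F x + F y + F z) * tri_weight (a, b)
     = ((?H a + ?H b + ?H (L_const - a - b)) *
         (ennreal (tri_density L_const a) * indicator {0..} a * indicator {0..} b * indicator {..L_const} (a + b)))" for a b
    by (simp only: tri_map_def tri_weight_def prod.case mult_ac)
  have split': "(case (ray_map (s, u)) of (x, y, z) \<Rightarrow> F x + F y + F z) * ray_weight (s, u)
     = ((?H (L_const * (1 - u)) + ?H (s * u) + ?H ((L_const - s) * u)) *
         (ennreal (s * ray_density L_const s) * indicator {0..L_const} s * indicator {0..1} u))" for s u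
    by (simp only: ray_map_def ray_weight_def prod.case mult_ac)
  have tri: "(\<integral>\<^sup>+(x, y, z). F x + F y + F z \<partial>tri_measure)
      = ennreal l_const * (\<integral>\<^sup>+a. ?H a * ennreal (?P a) * indicator {0..L_const} a \<partial>lborel)"
  proof -
    have "(\<integral>\<^sup>+(x, y, z). F x + F y + F z \<partial>tri_measure)
      = ennreal l_const * (\<integral>\<^sup>+a. \<integral>\<^sup>+b. (?H a + ?H b + ?H (L_const - a - b)) *
         (ennreal (tri_density L_const a) * indicator {0..} a * indicator {0..} b * indicator {..L_const} (a + b)) \<partial>lborel \<partial>lborel)"
      unfolding tri_measure_def
      by (subst nn_integral_distr_density_plane) (measurable, simp only: split)
    also have "\<dots> = ennreal l_const * (\<integral>\<^sup>+a. ?H a * ennreal (?P a) * indicator {0..L_const} a \<partial>lborel)"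
      using tri_density_nonneg tri_primitive_deriv[OF L(1)]
      by (subst triangle_marginals[where \<Phi> = "tri_primitive L_const"]) auto
    finally show ?thesis .
  qed
  have ray: "(\<integral>\<^sup>+(x, y, z). F x + F y + F z \<partial>ray_measure)
      = ennreal l_const * (\<integral>\<^sup>+a. ?H a * ennreal (?Q a) * indicator {0..L_const} a \<partial>lborel)"
  proof -
    have "(\<integral>\<^sup>+(x, y, z). F x + F y + F z \<partial>ray_measure)
      = ennreal l_const * (\<integral>\<^sup>+s. \<integral>\<^sup>+u. (?H (L_const * (1 - u)) + ?H (s * u) + ?H ((L_const - s) * u)) *
         (ennreal (s * ray_density L_const s) * indicator {0..L_const} s * indicator {0..1} u) \<partial>lborel \<partial>lborel)"
      unfolding ray_measure_def
      by (subst nn_integral_distr_density_plane) (measurable, simp only: split')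
    also have "\<dots> = ennreal l_const * (\<integral>\<^sup>+a. ?H a * ennreal (?Q a) * indicator {0..L_const} a \<partial>lborel)"
      using ray_density_nonneg[OF L(2)] ray_density_reflect mass ray_primitive_deriv[OF L(1)] L
      by (subst ray_marginals[where W = "ray_primitive L_const"]) auto
    finally show ?thesis .
  qed
  let ?F = "\<lambda>G. \<integral>\<^sup>+a. ?H a * ennreal (G a) * indicator {0..L_const} a \<partial>lborel"
  have [measurable]: "tri_primitive L_const \<in> borel_measurable borel" "ray_primitive L_const \<in> borel_measurable borel"
    using tri_primitive_deriv[OF L(1)] ray_primitive_deriv[OF L(1)]
    by (blast intro: borel_measurable_continuous_onI continuous_at_imp_continuous_on DERIV_isCont)+
  have "ennreal l_const * ?F ?P + ennreal l_const * ?F ?Q = ennreal l_const * (?F ?P + ?F ?Q)"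
    by (simp only: distrib_left)
  also have "?F ?P + ?F ?Q = (\<integral>\<^sup>+a. ?H a * ennreal (?P a) * indicator {0..L_const} a
      + ?H a * ennreal (?Q a) * indicator {0..L_const} a \<partial>lborel)"
    by (rule nn_integral_add[symmetric]) measurable
  also have "\<dots> = ?F (\<lambda>a. exp (L_const - a))"
  proof (intro nn_integral_cong)
    fix a :: real
    show "?H a * ennreal (?P a) * indicator {0..L_const} a + ?H a * ennreal (?Q a) * indicator {0..L_const} a
       = ?H a * ennreal (exp (L_const - a)) * indicator {0..L_const} a"
    proof (cases "0 \<le> a \<and> a \<le> L_const")
      case True
      hence "ennreal (exp (L_const - a)) = ennreal (?P a) + ennreal (?Q a)"
        using P[of a] Q[of a] by (simp only: ennreal_plus PQ[symmetric])
      thus ?thesis by (simp only: distrib_left distrib_right)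
    qed auto
  qed
  \<comment> \<open>The factor l turns e^(L - a) into \<open>log_chart a\<close>, which is also the
    absolute Jacobian of the chart.\<close>
  also have "ennreal l_const * \<dots> = (\<integral>\<^sup>+a. F (log_chart a) * ennreal (log_chart a) * indicator {0..L_const} a \<partial>lborel)"
    using l_const_pos
    by (subst nn_integral_cmult[symmetric]) (auto simp: log_chart_def ennreal_mult mult_ac)
  also have "\<dots> = (\<integral>\<^sup>+x. F x * indicator {l_const..r_const} x \<partial>lborel)"
    using nn_integral_exp_reflect[OF F l_const_pos(1) L(1)] by (simp add: log_chart_def l_const_exp)
  finally show ?thesis by (simp only: tri ray)
qed

section \<open>Sum of the three components and its symmetrization\<close>

theorem theorem3p14:
  shows "\<exists>\<mu>. stochastic_3_1 \<mu> \<and> emeasure \<mu> M_set = 1"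
proof -
  let ?S = "\<lambda>(F :: real \<Rightarrow> ennreal) (x, y, z). F x + F y + F z"
  define N where "N = (\<lambda>i :: nat. if i = 0 then seg_measure else if i = 1 then tri_measure else ray_measure)"
  have sets_N: "sets (N i) = sets borel" for i
    by (simp add: N_def seg_measure_def tri_measure_def ray_measure_def)
  have total: "(\<Sum>i<3. \<integral>\<^sup>+p. ?S F p \<partial>N i) = (\<integral>\<^sup>+x. F x * indicator {0..1} x \<partial>lborel)"
    if F[measurable]: "F \<in> borel_measurable borel" for F
  proof -
    have "(\<Sum>i<3. \<integral>\<^sup>+p. ?S F p \<partial>N i) = (\<integral>\<^sup>+p. ?S F p \<partial>seg_measure)
        + ((\<integral>\<^sup>+p. ?S F p \<partial>tri_measure) + (\<integral>\<^sup>+p. ?S F p \<partial>ray_measure))"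
      by (simp add: N_def eval_nat_numeral lessThan_Suc add_ac)
    also have "\<dots> = (\<integral>\<^sup>+x. F x * indicator {0..l_const} x \<partial>lborel)
        + (\<integral>\<^sup>+x. F x * indicator {r_const..1} x \<partial>lborel) + (\<integral>\<^sup>+x. F x * indicator {l_const..r_const} x \<partial>lborel)"
      by (simp only: seg_marginals[OF F] tri_ray_marginals[OF F])
    also have "\<dots> = (\<integral>\<^sup>+x. F x * indicator {0..l_const} x + F x * indicator {r_const..1} x
        + F x * indicator {l_const..r_const} x \<partial>lborel)"
      by (rule nn_integral_add3[symmetric]) measurable
    also have "\<dots> = (\<integral>\<^sup>+x. F x * indicator {0..1} x \<partial>lborel)"
    proof (rule nn_integral_cong_AE)
      have "AE x in lborel. x \<noteq> l_const \<and> x \<noteq> r_const"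
        using AE_lborel_singleton[of l_const] AE_lborel_singleton[of r_const] by eventually_elim simp
      thus "AE x in lborel. F x * indicator {0..l_const} x + F x * indicator {r_const..1} x
          + F x * indicator {l_const..r_const} x = F x * indicator {0..1} x"
        by eventually_elim (use l_const_pos l_const_bounds in \<open>auto simp: indicator_def r_const_def\<close>)
    qed
    finally show ?thesis .
  qed
  have mass: "emeasure (N i) (space (N i)) \<le> 1" if "i < 3" for i
  proof -
    \<comment> \<open>The bound needs no computation of masses: by \<open>total\<close> with F = 1,
      three times the sum of all masses is 1.\<close>
    have "emeasure (N i) (space (N i)) \<le> 3 * emeasure (N i) (space (N i))"
      using mult_right_mono[of 1 "3 :: ennreal" "emeasure (N i) (space (N i))"] by simp
    also have "\<dots> = (\<integral>\<^sup>+p. ?S (\<lambda>_. 1) p \<partial>N i)" by (simp add: split_beta')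
    also have "\<dots> \<le> (\<Sum>i<3. \<integral>\<^sup>+p. ?S (\<lambda>_. 1) p \<partial>N i)"
      using that by (intro member_le_sum) auto
    also have "\<dots> = 1" by (subst total) auto
    finally show ?thesis .
  qed
  have sub: "N i \<in> space (subprob_algebra borel)" if "i < 3" for i
    using mass[OF that] sets_N[of i] sets_eq_imp_space_eq[OF sets_N[of i]]
    by (auto simp: space_subprob_algebra intro!: subprob_spaceI)
  obtain \<nu> where sets_nu: "sets \<nu> = sets borel"
    and nu: "\<And>f. f \<in> borel_measurable borel \<Longrightarrow> (\<integral>\<^sup>+p. f p \<partial>\<nu>) = (\<Sum>i<3. \<integral>\<^sup>+p. f p \<partial>N i)"
    using finite_sum_measure[of 3 N borel] sub by auto
  have M[measurable]: "M_set \<in> sets borel" using M_set_closed by (rule borel_closed)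
  have I[measurable]: "(indicator (- M_set) :: _ \<Rightarrow> ennreal) \<in> borel_measurable borel" by measurable
  have seg0: "(\<integral>\<^sup>+p. indicator (- M_set) p \<partial>seg_measure) = 0"
  proof -
    have [measurable]: "(\<lambda>t. (t, 1 - 2 * t, 1 - 2 * t)) \<in> (borel :: real measure) \<rightarrow>\<^sub>M (borel :: (real \<times> real \<times> real) measure)"
      by (intro borel_measurable_continuous_onI continuous_intros)
    have "(\<integral>\<^sup>+p. indicator (- M_set) p \<partial>seg_measure)
       = (\<integral>\<^sup>+t. indicator {0..l_const} t * indicator (- M_set) (t, 1 - 2 * t, 1 - 2 * t) \<partial>lborel)"
      unfolding seg_measure_def by (subst nn_integral_distr; (subst nn_integral_density)?) auto
    also have "\<dots> = (\<integral>\<^sup>+t. 0 \<partial>(lborel :: real measure))"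
      by (intro nn_integral_cong) (auto simp: indicator_def M_set_def M_x_def)
    finally show ?thesis by simp
  qed
  have tri0: "(\<integral>\<^sup>+p. indicator (- M_set) p \<partial>tri_measure) = 0"
  proof -
    \<comment> \<open>Where the weight is nonzero, a, b and L - a - b are nonnegative with sum L, so
      the image lies in \<open>M_2\<close>.\<close>
    have "indicator (- M_set) (tri_map (a, b)) * tri_weight (a, b) = 0" for a b
      using log_chart_M_2[of a b "L_const - a - b"]
      by (auto simp: tri_map_def tri_weight_def M_set_def indicator_def)
    thus ?thesis unfolding tri_measure_def
      by (subst nn_integral_distr_density_plane) (measurable, simp only: nn_integral_const, simp)
  qed
  have ray0: "(\<integral>\<^sup>+p. indicator (- M_set) p \<partial>ray_measure) = 0"
  proof -
    have mem: "ray_map (s, u) \<in> M_set" if "s \<in> {0..L_const}" "u \<in> {0..1}" for s u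
    proof -
      have "L_const * (1 - u) + s * u + (L_const - s) * u = L_const" by (simp add: algebra_simps)
      moreover have "0 \<le> L_const * (1 - u)" "0 \<le> s * u" "0 \<le> (L_const - s) * u"
        using that by (auto intro!: mult_nonneg_nonneg)
      ultimately show ?thesis using log_chart_M_2 by (simp add: ray_map_def M_set_def)
    qed
    have "indicator (- M_set) (ray_map (s, u)) * ray_weight (s, u) = 0" for s u
      using mem[of s u] by (cases "s \<in> {0..L_const} \<and> u \<in> {0..1}") (auto simp: ray_weight_def)
    thus ?thesis unfolding ray_measure_def
      by (subst nn_integral_distr_density_plane) (measurable, simp only: nn_integral_const, simp)
  qed
  have null: "emeasure \<nu> (- M_set) = 0"
  proof -
    have "emeasure \<nu> (- M_set) = (\<integral>\<^sup>+p. indicator (- M_set) p \<partial>\<nu>)"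
      using sets_nu M by (intro nn_integral_indicator[symmetric]) auto
    also have "\<dots> = (\<Sum>i<3. \<integral>\<^sup>+p. indicator (- M_set) p \<partial>N i)" by (rule nu) measurable
    also have "\<dots> = 0" using seg0 tri0 ray0 by (auto simp: N_def intro!: sum.neutral)
    finally show ?thesis .
  qed
  show ?thesis
  proof (rule cyclic_symmetrization[OF sets_nu M M_set_subset_cube M_set_cyclic null])
    show "(\<integral>\<^sup>+p. ?S F p \<partial>\<nu>) = (\<integral>\<^sup>+x. F x * indicator {0..1} x \<partial>lborel)"
      if F: "F \<in> borel_measurable borel" for F
      using nu[OF sum_marginals_borel[OF F]] total[OF F] by simp
  qed auto
qed

end
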